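(* Let $d,n,j$ be integers with $n \ge 2d$ and $0 < j \le d$, and put $e = n-d$. Then $E_j(1)$ is the smallest eigenvalue of $J(n,d,j)$ (that is, $E_j(1)\le E_j(i)$ for all $0\le i\le d$) if and only if $j(n-1) \ge de$. In this case $E_j(1)$ is also the second largest in absolute value among the eigenvalues of $J(n,d,j)$ (that is, $|E_j(i)| \le |E_j(1)|$ for all $1 \le i \le d$).
   Context: For $n\ge 2d$ and $0\le j\le d$, $J(n,d,j)$ is the graph whose vertices are the $d$-subsets of a fixed $n$-set, two vertices being adjacent when they meet in exactly $d-j$ elements. Its eigenvalues are the numbers $$E_j(i) = \sum_{h=0}^j (-1)^h \binom{i}{h} \binom{d-i}{j-h} \binom{n-d-i}{j-h},\qquad 0\le i\le d,$$ and $E_j(0)=\binom{d}{j}\binom{n-d}{j}$ is the valency (the largest eigenvalue). *)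

theory Defs
  imports "Graph_Theory.Graph_Theory" "Jordan_Normal_Form.Spectral_Radius"
begin

text \<open>The graph $J(n,d,j)$ on the $d$-subsets of $\{0,\dots,n-1\}$. An undirected graph is
  represented by a symmetric set of arcs.\<close>

definition johnson_graph :: "nat \<Rightarrow> nat \<Rightarrow> nat \<Rightarrow> nat set pair_pre_digraph" where
  "johnson_graph n d j =
    \<lparr> pverts = {S. S \<subseteq> {0..<n} \<and> card S = d},
      parcs = {(S, T). S \<subseteq> {0..<n} \<and> card S = d \<and> T \<subseteq> {0..<n} \<and> card T = d
                 \<and> card (S \<inter> T) = d - j} \<rparr>"

lemma johnson_graph_pair_graph:
  assumes "0 < j" "j \<le> d"
  shows "pair_graph (johnson_graph n d j)"
proof
  have fin: "finite {S. S \<subseteq> {0..<n} \<and> card S = d}"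
    by (rule finite_subset[of _ "Pow {0..<n}"]) blast+
  then show "finite (pverts (johnson_graph n d j))"
    by (simp add: johnson_graph_def)
  have "parcs (johnson_graph n d j) \<subseteq>
      {S. S \<subseteq> {0..<n} \<and> card S = d} \<times> {S. S \<subseteq> {0..<n} \<and> card S = d}"
    unfolding johnson_graph_def by simp blast
  then show "finite (parcs (johnson_graph n d j))"
    using fin by (blast intro: finite_subset finite_cartesian_product)
  show "symmetric (with_proj (johnson_graph n d j))"
    unfolding symmetric_def with_proj_simps
    by (rule symI) (simp add: johnson_graph_def Int_commute)
next
  fix x assume x: "x \<in> parcs (johnson_graph n d j)"
  obtain S T where [simp]: "x = (S, T)" by (cases x)
  from x show "fst x \<in> pverts (johnson_graph n d j)" "snd x \<in> pverts (johnson_graph n d j)"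
    by (simp_all add: johnson_graph_def)
  from x assms show "fst x \<noteq> snd x"
    by (simp add: johnson_graph_def) (metis Int_absorb diff_less less_irrefl less_le_trans)
qed

text \<open>The order in which the vertices are enumerated is irrelevant: a different choice conjugates
  the adjacency matrix by a permutation matrix, which does not affect its eigenvalues.\<close>

definition vertex_list :: "'a pair_pre_digraph \<Rightarrow> 'a list" where
  "vertex_list G = (SOME vs. distinct vs \<and> set vs = pverts G)"

definition adjacency_matrix :: "'a pair_pre_digraph \<Rightarrow> real mat" where
  "adjacency_matrix G = (let vs = vertex_list G in
     mat (length vs) (length vs) (\<lambda>(a, b). if (vs ! a, vs ! b) \<in> parcs G then 1 else 0))"

definition graph_spectrum :: "'a pair_pre_digraph \<Rightarrow> real set" where
  "graph_spectrum G = spectrum (adjacency_matrix G)"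

definition smallest_eigenvalue :: "'a pair_pre_digraph \<Rightarrow> real \<Rightarrow> bool" where
  "smallest_eigenvalue G \<theta> \<longleftrightarrow> \<theta> \<in> graph_spectrum G \<and> (\<forall>\<mu>\<in>graph_spectrum G. \<theta> \<le> \<mu>)"

text \<open>The number $E_j(i)$. For $i \le d$ and $2d \le n$ no natural-number subtraction below
  truncates.\<close>

definition johnson_eigenvalue :: "nat \<Rightarrow> nat \<Rightarrow> nat \<Rightarrow> nat \<Rightarrow> real" where
  "johnson_eigenvalue n d j i =
    (\<Sum>h = 0..j. (-1) ^ h * real (i choose h) * real ((d - i) choose (j - h))
                  * real ((n - d - i) choose (j - h)))"

end

theory Submission
  imports Defs
begin

text \<open>
  With \<open>e = n - d\<close>, \<open>N = n\<close> and \<open>D = d * e\<close>, the eigenvalues satisfy the recursion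
  \<open>E d e j i = E (d-1) (e-1) j (i-1) - E (d-1) (e-1) (j-1) (i-1)\<close>, and
  \<open>D * E d e j 1 = - (j + t) * E d e j 0\<close> with \<open>t = j * (n - 1) - D\<close>, while \<open>E d e j 2 - E d e j 1\<close> has
  the sign of \<open>t\<close>; hence \<open>t \<ge> 0\<close> is necessary.

  For \<open>t \<ge> 0\<close> one shows \<open>\<bar>E d e j i\<bar> \<le> - E d e j 1\<close> by induction along the recursion. If
  \<open>t \<ge> 2 * (j - 1)\<close>, both terms on the right again satisfy the hypothesis, and the triangle inequality
  suffices. Otherwise the second term lies below the threshold, where \<open>E d e j 1\<close> can vanish. There
  one uses a weaker bound, valid for all \<open>j\<close> and all \<open>i \<ge> 1\<close>: if \<open>Q = E d e j i / E d e j 0\<close> and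
  \<open>x = j - D / N\<close>, then \<open>\<bar>Q\<bar> \<le> N / (2 * D) * (1 + x\<^sup>2)\<close>. For \<open>i = 1\<close> this is the inequality
  \<open>2 * \<bar>x\<bar> \<le> 1 + x\<^sup>2\<close>, and it is inherited along the recursion. Since every step of the recursion
  roughly halves the size of \<open>Q\<close>, applying it two steps down gives the required bound.

  The numbers \<open>E d e j i\<close> are eigenvalues because the products of \<open>[a \<in> T] - [b \<in> T]\<close> over \<open>i\<close>
  disjoint pairs \<open>(a, b)\<close> are eigenvectors: removing a pair is the recursion above. There are no
  others: given an eigenvector, take a smallest set \<open>S\<close> such that the eigenvector is not orthogonal to
  all functions of \<open>T \<inter> S\<close>; minimality makes the sums over \<open>T \<inter> S = R\<close> alternate in sign with
  \<open>card (S - R)\<close>, which determines the eigenvalue from \<open>card S\<close>.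
\<close>

section \<open>The Eberlein recursion\<close>

text \<open>This is \<open>E_j(i)\<close> with \<open>e\<close> in place of \<open>n - d\<close>:
  the recursion lowers \<open>d\<close> and \<open>e\<close> together, hence \<open>n\<close> by
  two.\<close>

definition eberlein :: "nat \<Rightarrow> nat \<Rightarrow> nat \<Rightarrow> nat \<Rightarrow> real" where
  "eberlein d e j i =
    (\<Sum>h\<le>j. (-1) ^ h * real (i choose h) * real ((d - i) choose (j - h)) * real ((e - i) choose (j - h)))"

lemma johnson_eigenvalue_eq_eberlein: "johnson_eigenvalue n d j i = eberlein d (n - d) j i"
  by (simp add: johnson_eigenvalue_def eberlein_def atLeast0AtMost)

lemma eberlein_0_left [simp]: "eberlein d e 0 i = 1"
  by (simp add: eberlein_def)

lemma eberlein_0_right: "eberlein d e j 0 = real (d choose j) * real (e choose j)"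
proof -
  have "eberlein d e j 0 = (\<Sum>h\<in>{0}. (-1) ^ h * real (0 choose h) * real ((d - 0) choose (j - h))
      * real ((e - 0) choose (j - h)))"
    unfolding eberlein_def by (rule sum.mono_neutral_right) auto
  then show ?thesis by simp
qed

text \<open>Pascal's rule for \<open>Suc i choose h\<close>. The other two binomials stay put,
  because \<open>d - i\<close> and \<open>e - i\<close> do not change when \<open>d\<close>,
  \<open>e\<close> and \<open>i\<close> all drop by one.\<close>

lemma eberlein_Suc:
  "eberlein (Suc d) (Suc e) (Suc j) (Suc i) = eberlein d e (Suc j) i - eberlein d e j i"
proof -
  define f where "f h m = (-1) ^ h * real ((d - i) choose m) * real ((e - i) choose m)" for h m :: nat
  have "eberlein (Suc d) (Suc e) (Suc j) (Suc i) = (\<Sum>h\<le>Suc j. real (Suc i choose h) * f h (Suc j - h))"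
    by (simp add: eberlein_def f_def mult_ac)
  also have "\<dots> = f 0 (Suc j) + (\<Sum>h\<le>j. real (i choose Suc h) * f (Suc h) (j - h))
      + (\<Sum>h\<le>j. real (i choose h) * f (Suc h) (j - h))"
    by (subst sum.atMost_Suc_shift) (simp add: distrib_right sum.distrib add_ac)
  also have "f 0 (Suc j) + (\<Sum>h\<le>j. real (i choose Suc h) * f (Suc h) (j - h))
      = (\<Sum>h\<le>Suc j. real (i choose h) * f h (Suc j - h))"
    by (subst sum.atMost_Suc_shift) simp
  also have "\<dots> = eberlein d e (Suc j) i"
    by (simp add: eberlein_def f_def mult_ac)
  also have "(\<Sum>h\<le>j. real (i choose h) * f (Suc h) (j - h)) = - eberlein d e j i"
    by (simp add: eberlein_def f_def mult_ac sum_negf[symmetric])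
  finally show ?thesis by simp
qed

text \<open>A descent from \<open>d\<close> to \<open>d - 1\<close> with \<open>j\<close> fixed can
  push \<open>j\<close> above \<open>d\<close>; this disposes of those cases.\<close>

lemma eberlein_eq_0: "i \<le> d \<Longrightarrow> d < j \<Longrightarrow> eberlein d e j i = 0"
  unfolding eberlein_def
proof (rule sum.neutral, rule ballI)
  fix h assume "i \<le> d" "d < j"
  then have "i < h \<or> d - i < j - h" by linarith
  then show "(-1) ^ h * real (i choose h) * real ((d - i) choose (j - h)) * real ((e - i) choose (j - h)) = 0"
    by auto
qed

section \<open>Ratios of valencies and the eigenvalue at \<open>i = 1\<close>\<close>

lemma Suc_times_binomial_real: "real (Suc n) * real (n choose j) = (real (Suc n) - real j) * real (Suc n choose j)"
proof (cases "j \<le> Suc n")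
  case True
  have "(Suc n - j) * (Suc n choose j) = Suc n * (n choose j)"
    using binomial_absorb_comp[of "Suc n" j] by simp
  then show ?thesis
    using True by (metis of_nat_diff of_nat_mult)
qed (auto simp: binomial_eq_0)

text \<open>This and the next lemma give the weights \<open>(d - j) * (e - j)\<close> and
  \<open>j^2\<close> of the two terms of the recursion relative to the valency before the descent. A
  bound of the form \<open>f j * eberlein d e j 0\<close> thus passes through the recursion as an
  inequality about \<open>f\<close> alone.\<close>

lemma eberlein_0_pred:
  "real (Suc d) * real (Suc e) * eberlein d e j 0
    = (real (Suc d) - real j) * (real (Suc e) - real j) * eberlein (Suc d) (Suc e) j 0"
proof -
  have "real (Suc d) * real (Suc e) * eberlein d e j 0
      = (real (Suc d) * real (d choose j)) * (real (Suc e) * real (e choose j))"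
    by (simp add: eberlein_0_right)
  also have "\<dots> = (real (Suc d) - real j) * (real (Suc e) - real j) * eberlein (Suc d) (Suc e) j 0"
    unfolding Suc_times_binomial_real by (simp only: eberlein_0_right mult_ac)
  finally show ?thesis .
qed

lemma eberlein_0_pred_pred:
  "real (Suc d) * real (Suc e) * eberlein d e j 0
    = (real (Suc j))\<^sup>2 * eberlein (Suc d) (Suc e) (Suc j) 0"
proof -
  have *: "real (Suc n) * real (n choose j) = real (Suc j) * real (Suc n choose Suc j)" for n
    using Suc_times_binomial_eq[of n j] by (metis mult.commute of_nat_mult)
  have "real (Suc d) * real (Suc e) * eberlein d e j 0
      = (real (Suc d) * real (d choose j)) * (real (Suc e) * real (e choose j))"
    by (simp add: eberlein_0_right)
  also have "\<dots> = (real (Suc j))\<^sup>2 * eberlein (Suc d) (Suc e) (Suc j) 0"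
    unfolding * by (simp only: eberlein_0_right power2_eq_square mult_ac)
  finally show ?thesis .
qed

text \<open>The recursion at \<open>i = 0\<close> produces the factor
  \<open>(d - j) * (e - j) - j^2\<close>, in which the squares of \<open>j\<close> cancel.\<close>

lemma eberlein_1:
  assumes "0 < d" "0 < e"
  shows "real d * real e * eberlein d e j 1 = (real d * real e - real j * (real d + real e)) * eberlein d e j 0"
proof -
  obtain d' e' where [simp]: "d = Suc d'" "e = Suc e'"
    using assms by (metis Suc_pred)
  show ?thesis
  proof (cases j)
    case 0 then show ?thesis by simp
  next
    case (Suc m)
    have "real d * real e * eberlein d e j 1
        = real d * real e * eberlein d' e' (Suc m) 0 - real d * real e * eberlein d' e' m 0"
      using eberlein_Suc[of d' e' m 0] Suc by (simp add: right_diff_distrib)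
    also have "\<dots> = ((real d - real j) * (real e - real j) - (real j)\<^sup>2) * eberlein d e j 0"
      using eberlein_0_pred[of d' e' j] eberlein_0_pred_pred[of d' e' m] Suc
      by (simp only: \<open>d = _\<close> \<open>e = _\<close> left_diff_distrib)
    also have "\<dots> = (real d * real e - real j * (real d + real e)) * eberlein d e j 0"
      by (simp add: algebra_simps power2_eq_square)
    finally show ?thesis .
  qed
qed

section \<open>Two polynomial inequalities\<close>

text \<open>Positivity of this polynomial is the induction step of the bound \<open>crude_bound\<close> below.\<close>

definition crude_defect :: "real \<Rightarrow> real \<Rightarrow> real \<Rightarrow> real" where
  "crude_defect N D j =
    (D - N + 1) * (N - 2) * (N\<^sup>2 + (N * j - D)\<^sup>2)
    - N * ((D - N * j + j\<^sup>2) * ((N - 2)\<^sup>2 + ((N - 2) * j - (D - N + 1))\<^sup>2)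
           + j\<^sup>2 * ((N - 2)\<^sup>2 + ((N - 2) * (j - 1) - (D - N + 1))\<^sup>2))"

section \<open>Positivity of \<open>crude_defect\<close>\<close>

text \<open>After shifting \<open>d\<close> and \<open>e\<close> to nonnegative variables all
  coefficients are nonnegative. These three values of \<open>j\<close> are treated apart because the
  coefficient estimates below assume \<open>3 <= j\<close>.\<close>

lemma crude_defect_nonneg_small:
  assumes "3 \<le> d" "d \<le> e" "j = 0 \<or> j = 1 \<or> j = 2"
  shows "0 \<le> crude_defect (d + e) (d * e) j"
proof -
  define a b where "a = d - 3" and "b = e - d"
  have ab: "0 \<le> a" "0 \<le> b" "d = 3 + a" "e = 3 + a + b"
    using assms by (simp_all add: a_def b_def)
  show ?thesis
    using assms(3)
  proof (elim disjE)
    assume "j = 0"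
    have "crude_defect (d + e) (d * e) j = a^2 * b^4 + 4 * a^3 * b^3 + 7 * a^4 * b^2
        + 6 * a^5 * b + 2 * a^6 + 5 * a * b^4 + 30 * a^2 * b^3 + 70 * a^3 * b^2 + 75 * a^4 * b
        + 30 * a^5 + 68 * a * b^3 + 246 * a^2 * b^2 + 356 * a^3 * b + 178 * a^4 + 5 * b^4
        + 355 * a * b^2 + 795 * a^2 * b + 530 * a^3 + 45 * b^3 + 820 * a * b + 820 * a^2 + 172 * b^2 + 600 * a + 300 * b + 144"
      unfolding ab \<open>j = 0\<close> crude_defect_def by (simp add: algebra_simps eval_nat_numeral)
    then show ?thesis using ab by simp
  next
    assume "j = 1"
    have "crude_defect (d + e) (d * e) j = 2 * a^2 * b^4 + 10 * a^3 * b^3 + 20 * a^4 * b^2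
        + 18 * a^5 * b + 6 * a^6 + 7 * a * b^4 + 54 * a^2 * b^3 + 146 * a^3 * b^2
        + 165 * a^4 * b + 66 * a^5 + 96 * a * b^3 + 394 * a^2 * b^2 + 596 * a^3 * b + 298 * a^4
        + 6 * b^4 + 463 * a * b^2 + 1059 * a^2 * b + 706 * a^3 + 55 * b^3 + 916 * a * b
        + 916 * a^2 + 196 * b^2 + 600 * a + 300 * b + 144"
      unfolding ab \<open>j = 1\<close> crude_defect_def by (simp add: algebra_simps eval_nat_numeral)
    then show ?thesis using ab by simp
  next
    assume "j = 2"
    have "crude_defect (d + e) (d * e) j = 3 * a^2 * b^4 + 16 * a^3 * b^3 + 33 * a^4 * b^2
        + 30 * a^5 * b + 10 * a^6 + 5 * a * b^4 + 46 * a^2 * b^3 + 134 * a^3 * b^2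
        + 155 * a^4 * b + 62 * a^5 + 36 * a * b^3 + 142 * a^2 * b^2 + 212 * a^3 * b + 106 * a^4
        + 3 * b^4 + 35 * a * b^2 + 27 * a^2 * b + 18 * a^3 + 13 * b^3 + 20 * a * b + 20 * a^2
        + 20 * b^2 + 216 * a + 108 * b + 144"
      unfolding ab \<open>j = 2\<close> crude_defect_def by (simp add: algebra_simps eval_nat_numeral)
    then show ?thesis using ab by simp
  qed
qed

text \<open>The next polynomials are the coefficients of the powers of \<open>w\<close> in \<open>crude_defect N D j\<close> after the
  substitution \<open>N = 2 * (j + a) + w\<close>, \<open>D = (j + a)\<^sup>2 + j * w\<close>. For \<open>N = d + e\<close> and \<open>D = d * e\<close> this means
  \<open>a\<^sup>2 = (d - j) * (e - j)\<close>, so \<open>w \<ge> 0\<close> is the inequality between arithmetic and geometric mean.\<close>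

lemma crude_coeff0_nonneg:
  fixes a j :: real
  assumes "0 \<le> a" "3 \<le> j"
  shows "0 \<le> 4 * j^6 * a + 4 * j^5 * a^2 - 8 * j^4 * a^3 - 8 * j^3 * a^4 + 4 * j^2 * a^5
      + 4 * j * a^6 - 4 * j^5 * a - 2 * j^4 * a^2 + 8 * j^3 * a^3 - 2 * j^2 * a^4 - 4 * j * a^5
      + 2 * a^6 + 2 * j^6 + 10 * j^4 * a + 44 * j^3 * a^2 + 44 * j^2 * a^3 + 10 * j * a^4
      - 6 * a^5 - 6 * j^5 - 56 * j^3 * a - 108 * j^2 * a^2 - 56 * j * a^3 - 2 * a^4 - 2 * j^4
      + 62 * j^2 * a + 62 * j * a^2 + 14 * a^3 + 14 * j^3 - 16 * j * a - 8 * a^2 - 8 * j^2"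
proof -
  \<comment> \<open>The polynomial is symmetric in \<open>j\<close> and \<open>a\<close>, so it can
    be written in their sum and product, and \<open>2 * s * (s - 1)^2\<close> splits off. The other
    factor is controlled by \<open>4 * q <= s^2\<close>.\<close>
  define s q where "s = j + a" and "q = j * a"
  have s: "3 \<le> s" and q: "0 \<le> q" using assms by (simp_all add: s_def q_def)
  have "4 * q \<le> s\<^sup>2"
    using zero_le_power2[of "j - a"] by (simp add: s_def q_def power2_eq_square algebra_simps)
  then have "q * (4 * q) \<le> q * s\<^sup>2" using q by (rule mult_left_mono)
  moreover have "2 * q * (2 * s - 5) \<le> s\<^sup>2 / 2 * (2 * s - 5)"
    using \<open>4 * q \<le> s\<^sup>2\<close> s by (intro mult_right_mono) auto
  moreover have "0 \<le> s * (3 * s - 8)" using s by simp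
  ultimately have "0 \<le> s * (s\<^sup>2 - s - 4) + 2 * q * (s\<^sup>2 - 2 * s + 5) - 8 * q\<^sup>2"
    by (simp add: algebra_simps power2_eq_square)
  then have "0 \<le> 2 * s * (s - 1)\<^sup>2 * (s * (s\<^sup>2 - s - 4) + 2 * q * (s\<^sup>2 - 2 * s + 5) - 8 * q\<^sup>2)"
    using s by simp
  also have "\<dots> = 4 * j^6 * a + 4 * j^5 * a^2 - 8 * j^4 * a^3 - 8 * j^3 * a^4
      + 4 * j^2 * a^5 + 4 * j * a^6 - 4 * j^5 * a - 2 * j^4 * a^2 + 8 * j^3 * a^3
      - 2 * j^2 * a^4 - 4 * j * a^5 + 2 * a^6 + 2 * j^6 + 10 * j^4 * a + 44 * j^3 * a^2
      + 44 * j^2 * a^3 + 10 * j * a^4 - 6 * a^5 - 6 * j^5 - 56 * j^3 * a - 108 * j^2 * a^2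
      - 56 * j * a^3 - 2 * a^4 - 2 * j^4 + 62 * j^2 * a + 62 * j * a^2 + 14 * a^3 + 14 * j^3 - 16 * j * a - 8 * a^2 - 8 * j^2"
    unfolding s_def q_def by (simp add: algebra_simps eval_nat_numeral)
  finally show ?thesis .
qed

lemma crude_coeff1_nonneg:
  fixes a j :: real
  assumes "0 \<le> a" "3 \<le> j"
  shows "0 \<le> 4 * j^5 * a - 4 * j^4 * a^2 - 8 * j^3 * a^3 + 2 * j^2 * a^4 + 4 * j * a^5
      + 2 * j^6 - 4 * j^4 * a + 4 * j^3 * a^2 - 2 * j * a^4 + 4 * a^5 - 2 * j^5 + 48 * j^3 * a
      + 70 * j^2 * a^2 + 24 * j * a^3 - 11 * a^4 + 5 * j^4 - 120 * j^2 * a - 108 * j * a^2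
      - 16 * a^3 - 28 * j^3 + 72 * j * a + 31 * a^2 + 31 * j^2 - 8 * a - 8 * j"
proof -
  define x where "x = j - 3"
  have x: "0 \<le> x" "j = 3 + x" using assms by (simp_all add: x_def)
  have "0 \<le> (8 * x^2 * a^2 + 64 * x^2 * a + 194 * x * a + 15 * x^2 + 134 * a) * (x + 2
      - a)^2 + (8 * x^3 * a + 2 * x^2 * a^2 + 4 * x * a^3 + 2 * x^4 + 66 * x * a^2 + 16 * a^3
      + 22 * x^3 + 73 * a^2) * (x + 3 - a)^2 + (24 * x * a^3 + 24 * a^4 + 80 * x^4
      + 70 * x^2 * a + 674 * x^3 + 524 * x * a + 1879 * x^2 + 536 * a + 2068 * x + 876)"
    using assms x by simp
  also have "\<dots> = 4 * j^5 * a - 4 * j^4 * a^2 - 8 * j^3 * a^3 + 2 * j^2 * a^4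
      + 4 * j * a^5 + 2 * j^6 - 4 * j^4 * a + 4 * j^3 * a^2 - 2 * j * a^4 + 4 * a^5 - 2 * j^5
      + 48 * j^3 * a + 70 * j^2 * a^2 + 24 * j * a^3 - 11 * a^4 + 5 * j^4 - 120 * j^2 * a
      - 108 * j * a^2 - 16 * a^3 - 28 * j^3 + 72 * j * a + 31 * a^2 + 31 * j^2 - 8 * a - 8 * j"
    unfolding x by (simp add: algebra_simps eval_nat_numeral)
  finally show ?thesis .
qed

lemma crude_coeff2_nonneg:
  fixes a j :: real
  assumes "0 \<le> a" "3 \<le> j"
  shows "0 \<le> -2 * j^3 * a^2 + j * a^4 + j^5 + a^4 - j^4 + 36 * j^2 * a + 22 * j * a^2
      - 6 * a^3 + 12 * j^3 - 60 * j * a - 20 * a^2 - 30 * j^2 + 18 * a + 18 * j - 2"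
proof -
  define x where "x = j - 3"
  have x: "0 \<le> x" "j = 3 + x" using assms by (simp_all add: x_def)
  \<comment> \<open>The same kind of certificate, for twice the polynomial.\<close>
  have "0 \<le> (2 * x^2 * a + 2 * x * a^2 + 5 * x * a + 8 * a^2) * (x + 2 - a)^2
      + (2 * x^2 * a + 2 * x^3 + 19 * x * a + 16 * x^2 + 8 * a) * (x + 3 - a)^2 + (46 * x * a^2
      + 12 * a^3 + 66 * x^3 + 73 * x * a + 444 * x^2 + 252 * a + 918 * x + 536)"
    using assms x by simp
  also have "\<dots> = 2 * (-2 * j^3 * a^2 + j * a^4 + j^5 + a^4 - j^4 + 36 * j^2 * a
      + 22 * j * a^2 - 6 * a^3 + 12 * j^3 - 60 * j * a - 20 * a^2 - 30 * j^2 + 18 * a + 18 * j - 2)"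
    unfolding x by (simp add: algebra_simps eval_nat_numeral)
  finally show ?thesis by simp
qed

text \<open>For large \<open>a\<close> the coefficient of \<open>w^3\<close> may be negative; the
  surplus \<open>a^4 / 8\<close> found here in the coefficient of \<open>w^2\<close> pays for
  it.\<close>

lemma crude_coeff2_lower:
  fixes a j :: real
  assumes "2 * j \<le> a" "3 \<le> j"
  shows "a^4 \<le> 8 * (-2 * j^3 * a^2 + j * a^4 + j^5 + a^4 - j^4 + 36 * j^2 * a
      + 22 * j * a^2 - 6 * a^3 + 12 * j^3 - 60 * j * a - 20 * a^2 - 30 * j^2 + 18 * a + 18 * j - 2)"
proof -
  define x z where "x = j - 3" and "z = a - 2 * j"
  have x: "0 \<le> x" "j = 3 + x" "0 \<le> z" "a = 6 + 2 * x + z"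
    using assms by (simp_all add: x_def z_def)
  have "0 \<le> 8 * x * z^4 + 64 * x^2 * z^3 + 176 * x^3 * z^2 + 192 * x^4 * z + 72 * x^5
      + 440 * x * z^3 + 1752 * x^2 * z^2 + 2528 * x^3 * z + 1184 * x^4 + 31 * z^4
      + 5648 * x * z^2 + 12800 * x^2 * z + 8720 * x^3 + 696 * z^3 + 28160 * x * z + 32144 * x^2
      + 5768 * z^2 + 56568 * x + 22128 * z + 37424"
    using x by simp
  also have "\<dots> = 8 * (-2 * j^3 * a^2 + j * a^4 + j^5 + a^4 - j^4 + 36 * j^2 * a
      + 22 * j * a^2 - 6 * a^3 + 12 * j^3 - 60 * j * a - 20 * a^2 - 30 * j^2 + 18 * a + 18 * j - 2) - a^4"
    unfolding x by (simp add: algebra_simps eval_nat_numeral)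
  finally show ?thesis by simp
qed
text \<open>As a polynomial in \<open>w\<close>, only the coefficient \<open>c3\<close> of
  \<open>w^3\<close> can be negative, and only for \<open>a > 2 * j\<close>. Then
  \<open>c3 >= - a^2\<close>, and the last three coefficients together dominate
  \<open>a^4 / 8 - a^2 * w + 2 * w^2\<close>, which is \<open>(a^2 - 4 * w)^2 / 8\<close>.\<close>

lemma crude_defect_nonneg_large:
  fixes a j w :: real
  assumes "0 \<le> a" "3 \<le> j" "0 \<le> w"
  shows "0 \<le> crude_defect (2 * (j + a) + w) ((j + a)\<^sup>2 + j * w) j"
proof -
  define c0 where "c0 = 4 * j^6 * a + 4 * j^5 * a^2 - 8 * j^4 * a^3 - 8 * j^3 * a^4
      + 4 * j^2 * a^5 + 4 * j * a^6 - 4 * j^5 * a - 2 * j^4 * a^2 + 8 * j^3 * a^3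
      - 2 * j^2 * a^4 - 4 * j * a^5 + 2 * a^6 + 2 * j^6 + 10 * j^4 * a + 44 * j^3 * a^2
      + 44 * j^2 * a^3 + 10 * j * a^4 - 6 * a^5 - 6 * j^5 - 56 * j^3 * a - 108 * j^2 * a^2
      - 56 * j * a^3 - 2 * a^4 - 2 * j^4 + 62 * j^2 * a + 62 * j * a^2 + 14 * a^3 + 14 * j^3 - 16 * j * a - 8 * a^2 - 8 * j^2"
  define c1 where "c1 = 4 * j^5 * a - 4 * j^4 * a^2 - 8 * j^3 * a^3 + 2 * j^2 * a^4
      + 4 * j * a^5 + 2 * j^6 - 4 * j^4 * a + 4 * j^3 * a^2 - 2 * j * a^4 + 4 * a^5 - 2 * j^5
      + 48 * j^3 * a + 70 * j^2 * a^2 + 24 * j * a^3 - 11 * a^4 + 5 * j^4 - 120 * j^2 * a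
      - 108 * j * a^2 - 16 * a^3 - 28 * j^3 + 72 * j * a + 31 * a^2 + 31 * j^2 - 8 * a - 8 * j"
  define c2 where "c2 = -2 * j^3 * a^2 + j * a^4 + j^5 + a^4 - j^4 + 36 * j^2 * a
      + 22 * j * a^2 - 6 * a^3 + 12 * j^3 - 60 * j * a - 20 * a^2 - 30 * j^2 + 18 * a + 18 * j - 2"
  define c3 where "c3 = 8 * j * a - a^2 + 6 * j^2 - 8 * a - 10 * j + 3"
  have c0: "0 \<le> c0" and c1: "0 \<le> c1" and c2: "0 \<le> c2"
    unfolding c0_def c1_def c2_def
    using crude_coeff0_nonneg crude_coeff1_nonneg crude_coeff2_nonneg assms by blast+
  have eq: "crude_defect (2 * (j + a) + w) ((j + a)\<^sup>2 + j * w) j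
      = c0 + c1 * w + w\<^sup>2 * (c2 + c3 * w + (j - 1) * w\<^sup>2)"
    unfolding crude_defect_def c0_def c1_def c2_def c3_def by (simp add: algebra_simps eval_nat_numeral)
  have "0 \<le> c2 + c3 * w + (j - 1) * w\<^sup>2"
  proof (cases "a \<le> 2 * j")
    case True
    have "a * a \<le> 2 * j * a" "3 * a \<le> j * a" "3 * j \<le> j * j"
      using True assms by (auto intro: mult_right_mono)
    then have "0 \<le> c3"
      using assms unfolding c3_def power2_eq_square by linarith
    then show ?thesis using c2 assms by simp
  next
    case False
    have "3 * a \<le> j * a" "3 * j \<le> j * j"
      using assms by (auto intro: mult_right_mono)
    then have "- (a\<^sup>2) \<le> c3"
      using assms unfolding c3_def power2_eq_square by linarith
    then have "- (a\<^sup>2) * w \<le> c3 * w"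
      using assms by (intro mult_right_mono)
    moreover have "2 * w\<^sup>2 \<le> (j - 1) * w\<^sup>2"
      using assms by (intro mult_right_mono) auto
    moreover have "a^4 \<le> 8 * c2"
      unfolding c2_def using False assms by (intro crude_coeff2_lower) auto
    moreover have "0 \<le> (a\<^sup>2 - 4 * w)\<^sup>2" by simp
    then have "8 * a\<^sup>2 * w \<le> a^4 + 16 * w\<^sup>2"
      by (simp add: power2_diff algebra_simps flip: power_mult)
    ultimately show ?thesis by linarith
  qed
  then show ?thesis
    using c0 c1 assms unfolding eq by simp
qed

lemma crude_defect_nonneg:
  assumes "3 \<le> d" "d \<le> e" "j \<le> d"
  shows "0 \<le> crude_defect (real d + real e) (real d * real e) (real j)"
proof (cases "j \<le> 2")
  case True
  then have "j = 0 \<or> j = 1 \<or> j = 2" by auto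
  then show ?thesis
    using assms by (intro crude_defect_nonneg_small) auto
next
  case False
  define u v where "u = real d - real j" and "v = real e - real j"
  have uv: "0 \<le> u" "0 \<le> v" "real d = real j + u" "real e = real j + v"
    using assms by (simp_all add: u_def v_def)
  \<comment> \<open>With this choice \<open>N\<close> and \<open>D\<close> are polynomials in
    \<open>j\<close>, \<open>a\<close> and \<open>w\<close>, although \<open>a\<close> itself is a
    square root.\<close>
  define a w where "a = sqrt (u * v)" and "w = u + v - 2 * a"
  have a2: "a\<^sup>2 = u * v" using uv by (simp add: a_def)
  have "2 * a \<le> u + v"
    using arith_geo_mean_sqrt[OF uv(1,2)] by (simp add: a_def)
  then have "0 \<le> crude_defect (2 * (real j + a) + w) ((real j + a)\<^sup>2 + real j * w) (real j)"
    using False uv by (intro crude_defect_nonneg_large) (simp_all add: a_def w_def)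
  also have "2 * (real j + a) + w = real d + real e"
    by (simp add: w_def uv)
  also have "(real j + a)\<^sup>2 + real j * w = real d * real e"
    by (simp add: w_def uv power2_sum a2 algebra_simps) (simp add: power2_eq_square)?
  finally show ?thesis .
qed

text \<open>Positivity of this polynomial allows \<open>crude_bound\<close> to be used two steps down the recursion.\<close>

definition two_step_defect :: "real \<Rightarrow> real \<Rightarrow> real \<Rightarrow> real" where
  "two_step_defect N D j =
    2 * (D - N + 1) * (D - 2 * N + 4) * (N - 4) * (N * j - D)
    - ((D - N * j + j\<^sup>2) * (D - N * j + j\<^sup>2 - N + 2 * j + 1)
          * ((N - 4)\<^sup>2 + ((N - 4) * j - (D - 2 * N + 4))\<^sup>2)
       + 2 * (D - N * j + j\<^sup>2) * j\<^sup>2 * ((N - 4)\<^sup>2 + ((N - 4) * (j - 1) - (D - 2 * N + 4))\<^sup>2)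
       + j\<^sup>2 * (j - 1)\<^sup>2 * ((N - 4)\<^sup>2 + ((N - 4) * (j - 2) - (D - 2 * N + 4))\<^sup>2))"

section \<open>Positivity of \<open>two_step_defect\<close> for
  \<open>0 <= t < 2 * (j - 1)\<close>\<close>

text \<open>In each of the four cells the slacks of the constraints serve as new nonnegative
  variables, and the expansion in them has only nonnegative coefficients. The gaps between the cells
  are harmless, since \<open>t\<close> will be an integer.\<close>

lemma two_step_defect_nonneg_cells:
  fixes j t N :: real
  assumes "3 \<le> j" "0 \<le> t" "4 * j - 2 \<le> N"
    and "t \<le> j - 3 \<and> 4 * j - 1 \<le> N \<or> t = j - 2 \<and> 4 * j - 1 \<le> N
      \<or> j - 1 \<le> t \<and> t \<le> 2 * j - 4 \<or> t = 2 * j - 3"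
  shows "0 \<le> two_step_defect N (j * (N - 1) - t) j"
  using assms(4)
proof (elim disjE)
  assume *: "t \<le> j - 3 \<and> 4 * j - 1 \<le> N"
  define v x u where "v = t" and "x = j - 3 - t" and "u = N - (4 * j - 1)"
  have sub: "0 \<le> v" "0 \<le> x" "0 \<le> u" "t = v" "N = 4 * (3 + v + x) - 1 + u" "j = 3 + v + x"
    using * assms(1-3) by (simp_all add: v_def x_def u_def)
  have eq: "two_step_defect N (j * (N - 1) - t) j = 288 * v * x^4 * u + 752 * v^2 * x^3 * u
      + 928 * v^3 * x^2 * u + 552 * v^4 * x * u + 128 * v^5 * u + 40 * x^5 * u
      + 80 * v * x^3 * u^2 + 156 * v^2 * x^2 * u^2 + 128 * v^3 * x * u^2 + 38 * v^4 * u^2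
      + 14 * x^4 * u^2 + 8 * v * x^2 * u^3 + 10 * v^2 * x * u^3 + 4 * v^3 * u^3 + 2 * x^3 * u^3
      + 288 * v * x^5 + 1016 * v^2 * x^4 + 1744 * v^3 * x^3 + 1596 * v^4 * x^2 + 752 * v^5 * x
      + 144 * v^6 + 28 * x^6 + 2398 * v * x^3 * u + 4625 * v^2 * x^2 * u + 3756 * v^3 * x * u
      + 1104 * v^4 * u + 425 * x^4 * u + 536 * v * x^2 * u^2 + 672 * v^2 * x * u^2
      + 268 * v^3 * u^2 + 132 * x^3 * u^2 + 40 * v * x * u^3 + 23 * v^2 * u^3 + 17 * x^2 * u^3
      + 2860 * v * x^4 + 8080 * v^2 * x^3 + 10364 * v^3 * x^2 + 6288 * v^4 * x + 1472 * v^5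
      + 328 * x^5 + 7228 * v * x^2 * u + 9160 * v^2 * x * u + 3664 * v^3 * u + 1735 * x^3 * u
      + 1152 * v * x * u^2 + 687 * v^2 * u^2 + 450 * x^2 * u^2 + 46 * v * u^3 + 47 * x * u^3
      + 10976 * v * x^3 + 23405 * v^2 * x^2 + 19980 * v^3 * x + 6030 * v^4 + 1520 * x^4
      + 9310 * v * x * u + 5846 * v^2 * u + 3370 * x^2 * u + 800 * v * u^2 + 652 * x * u^2
      + 42 * u^3 + 20208 * v * x^2 + 29174 * v^2 * x + 12484 * v^3 + 3496 * x^3 + 4286 * v * u
      + 3070 * x * u + 336 * u^2 + 17624 * v * x + 13114 * v^2 + 4034 * x^2 + 1020 * u + 5680 * v + 1958 * x + 132"
    unfolding sub two_step_defect_def by (simp add: algebra_simps eval_nat_numeral)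
  show ?thesis
    unfolding eq using sub(1-3) by (intro add_nonneg_nonneg) simp_all
next
  assume *: "t = j - 2 \<and> 4 * j - 1 \<le> N"
  define x u where "x = j - 3" and "u = N - (4 * j - 1)"
  have sub: "0 \<le> x" "0 \<le> u" "t = 1 + x" "N = 4 * (3 + x) - 1 + u" "j = 3 + x"
    using * assms(1-3) by (simp_all add: x_def u_def)
  have eq: "two_step_defect N (j * (N - 1) - t) j = 128 * x^5 * u + 38 * x^4 * u^2
      + 4 * x^3 * u^3 + 144 * x^6 + 1192 * x^4 * u + 292 * x^3 * u^2 + 25 * x^2 * u^3
      + 1584 * x^5 + 4324 * x^3 * u + 819 * x^2 * u^2 + 52 * x * u^3 + 7098 * x^4
      + 7659 * x^2 * u + 1018 * x * u^2 + 41 * u^3 + 16556 * x^3 + 6568 * x * u + 469 * u^2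
      + 21041 * x^2 + 2139 * u + 13610 * x + 3399"
    unfolding sub two_step_defect_def by (simp add: algebra_simps eval_nat_numeral)
  show ?thesis
    unfolding eq using sub(1-2) by (intro add_nonneg_nonneg) simp_all
next
  assume *: "j - 1 \<le> t \<and> t \<le> 2 * j - 4"
  define v x u where "v = t - (j - 1)" and "x = 2 * j - 4 - t" and "u = N - (4 * j - 2)"
  have sub: "0 \<le> v" "0 \<le> x" "0 \<le> u" "t = 2 + 2 * v + x" "N = 4 * (3 + v + x) - 2 + u" "j = 3 + v + x"
    using * assms(1-3) by (simp_all add: v_def x_def u_def)
  have eq: "two_step_defect N (j * (N - 1) - t) j = 728 * v * x^4 * u + 1632 * v^2 * x^3 * u
      + 1808 * v^3 * x^2 * u + 992 * v^4 * x * u + 216 * v^5 * u + 128 * x^5 * u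
      + 176 * v * x^3 * u^2 + 300 * v^2 * x^2 * u^2 + 224 * v^3 * x * u^2 + 62 * v^4 * u^2
      + 38 * x^4 * u^2 + 14 * v * x^2 * u^3 + 16 * v^2 * x * u^3 + 6 * v^3 * u^3
      + 4 * x^3 * u^3 + 976 * v * x^5 + 2716 * v^2 * x^4 + 3984 * v^3 * x^3 + 3256 * v^4 * x^2
      + 1408 * v^5 * x + 252 * v^6 + 144 * x^6 + 5428 * v * x^3 * u + 9041 * v^2 * x^2 * u
      + 6614 * v^3 * x * u + 1797 * v^4 * u + 1204 * x^4 * u + 1038 * v * x^2 * u^2
      + 1160 * v^2 * x * u^2 + 426 * v^3 * u^2 + 304 * x^3 * u^2 + 60 * v * x * u^3
      + 33 * v^2 * u^3 + 27 * x^2 * u^3 + 8808 * v * x^4 + 19484 * v^2 * x^3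
      + 21288 * v^3 * x^2 + 11516 * v^4 * x + 2472 * v^5 + 1568 * x^5 + 14590 * v * x^2 * u
      + 15996 * v^2 * x * u + 5767 * v^3 * u + 4364 * x^3 * u + 1928 * v * x * u^2
      + 1043 * v^2 * u^2 + 870 * x^2 * u^2 + 57 * v * u^3 + 58 * x * u^3 + 30896 * v * x^3
      + 50880 * v^2 * x^2 + 36750 * v^3 * x + 9849 * v^4 + 6916 * x^4 + 16814 * v * x * u
      + 9119 * v^2 * u + 7613 * x^2 * u + 1145 * v * u^2 + 1054 * x * u^2 + 40 * u^3
      + 52740 * v * x^2 + 57512 * v^2 * x + 20609 * v^3 + 15820 * x^3 + 6993 * v * u
      + 6368 * x * u + 452 * u^2 + 43782 * v * x + 23739 * v^2 + 19772 * x^2 + 2028 * u + 14103 * v + 12768 * x + 3312"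
    unfolding sub two_step_defect_def by (simp add: algebra_simps eval_nat_numeral)
  show ?thesis
    unfolding eq using sub(1-3) by (intro add_nonneg_nonneg) simp_all
next
  assume *: "t = 2 * j - 3"
  define v u where "v = j - 3" and "u = N - (4 * j - 2)"
  have sub: "0 \<le> v" "0 \<le> u" "t = 3 + 2 * v" "N = 4 * (3 + v) - 2 + u" "j = 3 + v"
    using * assms(1-3) by (simp_all add: v_def u_def)
  have eq: "two_step_defect N (j * (N - 1) - t) j = 216 * v^5 * u + 62 * v^4 * u^2
      + 6 * v^3 * u^3 + 252 * v^6 + 1885 * v^4 * u + 450 * v^3 * u^2 + 35 * v^2 * u^3
      + 2576 * v^5 + 6341 * v^3 * u + 1161 * v^2 * u^2 + 63 * v * u^3 + 10689 * v^4
      + 10405 * v^2 * u + 1299 * v * u^2 + 39 * u^3 + 23199 * v^3 + 8316 * v * u + 528 * u^2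
      + 27782 * v^2 + 2568 * u + 17352 * v + 4392"
    unfolding sub two_step_defect_def by (simp add: algebra_simps eval_nat_numeral)
  show ?thesis
    unfolding eq using sub(1-2) by (intro add_nonneg_nonneg) simp_all
qed

text \<open>The lower bounds on \<open>N\<close> in the cells come from the inequality between
  arithmetic and geometric mean: \<open>d - j\<close> and \<open>e - j\<close> have sum
  \<open>N - 2 * j\<close> and product \<open>j * (j - 1) - t\<close>, so a small \<open>t\<close>
  forces a large \<open>N\<close>.\<close>

lemma two_step_defect_nonneg:
  fixes d e j :: nat
  defines "t \<equiv> int j * (int d + int e - 1) - int d * int e"
  assumes "4 \<le> d" "d \<le> e" "j \<le> d" "0 \<le> t" "t < 2 * (int j - 1)"
  shows "0 \<le> two_step_defect (real d + real e) (real d * real e) (real j)"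
proof -
  define N where "N = int d + int e"
  \<comment> \<open>This excludes \<open>j = 2\<close>, where \<open>t >= 0\<close> would give
    \<open>2 * (N - 1) >= 4 * N - 16\<close> and so \<open>N <= 7\<close>.\<close>
  have "0 \<le> (int d - 4) * (int e - 4)" using assms by simp
  then have D: "4 * N - 16 \<le> int d * int e" by (simp add: N_def algebra_simps)
  have t: "t = int j * (N - 1) - int d * int e" by (simp add: t_def N_def)
  have "1 < int j" using \<open>0 \<le> t\<close> \<open>t < 2 * (int j - 1)\<close> by presburger
  then have "2 \<le> j" by simp
  moreover have "j \<noteq> 2"
  proof
    assume "j = 2"
    then have "2 * (N - 1) \<ge> 4 * N - 16" using t D \<open>0 \<le> t\<close> by simp
    then show False using assms(2,3) by (simp add: N_def)
  qed
  ultimately have j: "3 \<le> j" by simp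
  define m where "m = N - 2 * int j"
  have m: "0 \<le> m" using assms by (simp add: m_def N_def)
  have "4 * (int j * (int j - 1) - t) = 4 * ((int d - int j) * (int e - int j))"
    by (simp add: t_def algebra_simps)
  also have "\<dots> \<le> m\<^sup>2"
    using zero_le_power2[of "int d - int e"] by (simp add: m_def N_def power2_eq_square algebra_simps)
  finally have p: "4 * (int j * (int j - 1) - t) \<le> m\<^sup>2" .
  have N1: "4 * int j - 2 \<le> N"
  proof (rule ccontr)
    assume "\<not> ?thesis"
    then have "m \<le> 2 * int j - 3" by (simp add: m_def)
    then have "m\<^sup>2 \<le> (2 * int j - 3)\<^sup>2" using m by (intro power_mono)
    then show False using p \<open>t < 2 * (int j - 1)\<close> by (simp add: power2_eq_square algebra_simps)
  qed
  have N2: "4 * int j - 1 \<le> N" if "t \<le> int j - 2"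
  proof (rule ccontr)
    assume "\<not> ?thesis"
    then have "m \<le> 2 * int j - 2" by (simp add: m_def)
    then have "m\<^sup>2 \<le> (2 * int j - 2)\<^sup>2" using m by (intro power_mono)
    then show False using p that by (simp add: power2_eq_square algebra_simps)
  qed
  have cases: "t \<le> int j - 3 \<and> 4 * int j - 1 \<le> N \<or> t = int j - 2 \<and> 4 * int j - 1 \<le> N
      \<or> int j - 1 \<le> t \<and> t \<le> 2 * int j - 4 \<or> t = 2 * int j - 3"
    using N2 \<open>t < 2 * (int j - 1)\<close> by presburger
  have "0 \<le> two_step_defect (of_int N) (real j * (of_int N - 1) - of_int t) (real j)"
  proof (rule two_step_defect_nonneg_cells)
    show "4 * real j - 2 \<le> of_int N" using N1 by linarith
    show "of_int t \<le> real j - 3 \<and> 4 * real j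
        - 1 \<le> of_int N \<or> of_int t = real j - 2 \<and> 4 * real j - 1 \<le> of_int N
      \<or> real j - 1 \<le> of_int t \<and> of_int t \<le> 2 * real j - 4 \<or> of_int t = 2 * real j - 3"
      using cases by linarith
  qed (use j \<open>0 \<le> t\<close> in simp_all)
  also have "real j * (of_int N - 1) - of_int t = real d * real e"
    by (simp add: t_def N_def)
  also have "of_int N = real d + real e" by (simp add: N_def)
  finally show ?thesis .
qed

section \<open>Bounds for the eigenvalues\<close>

lemma eberlein_0_nonneg: "0 \<le> eberlein d e j 0"
  by (simp add: eberlein_0_right)

text \<open>This is \<open>N / (2 * D) * (1 + (x - D / N)^2)\<close> as a single fraction. The
  argument \<open>x\<close> is real, so that \<open>real j - 1\<close> is meaningful also for
  \<open>j = 0\<close>.\<close>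

definition crude_bound :: "real \<Rightarrow> real \<Rightarrow> real \<Rightarrow> real" where
  "crude_bound N D x = (N\<^sup>2 + (N * x - D)\<^sup>2) / (2 * D * N)"

lemma mult_crude_bound:
  "D \<noteq> 0 \<Longrightarrow> D * crude_bound N D x = (N\<^sup>2 + (N * x - D)\<^sup>2) / (2 * N)"
  by (simp add: crude_bound_def)

text \<open>The case \<open>i = 1\<close> of the crude bound: by \<open>eberlein_1\<close> the
  left-hand side is \<open>D\<close> times the absolute ratio of eigenvalue and valency.\<close>

lemma abs_le_crude_bound:
  assumes "0 < N" "0 < D"
  shows "\<bar>D - N * x\<bar> \<le> D * crude_bound N D x"
proof -
  have "0 \<le> (N - \<bar>D - N * x\<bar>)\<^sup>2" by simp
  then have "2 * N * \<bar>D - N * x\<bar> \<le> N\<^sup>2 + (N * x - D)\<^sup>2"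
    by (simp add: power2_diff algebra_simps)
  then show ?thesis
    using assms by (simp add: mult_crude_bound pos_le_divide_eq mult_ac)
qed

lemma frac_le_iff: "0 < b \<Longrightarrow> 0 < d \<Longrightarrow> a / b \<le> c / d \<longleftrightarrow> a * d \<le> c * b" for a b c d :: real
  by (simp add: field_simps)

text \<open>The nonnegativity of \<open>crude_defect\<close> with the denominators restored;
  \<open>N - 2\<close> and \<open>D - N + 1\<close> are the sum and the product of
  \<open>d - 1\<close> and \<open>e - 1\<close>.\<close>

lemma crude_bound_step:
  fixes d e j :: nat
  defines "N \<equiv> real d + real e" and "D \<equiv> real d * real e"
  assumes "3 \<le> d" "d \<le> e" "j \<le> d"
  shows "(real d - real j) * (real e - real j) * crude_bound (N - 2) (D - N + 1) (real j)
    + (real j)\<^sup>2 * crude_bound (N - 2) (D - N + 1) (real j - 1) \<le> D * crude_bound N D (real j)"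
proof -
  define g where "g x = (N - 2)\<^sup>2 + ((N - 2) * x - (D - N + 1))\<^sup>2" for x
  have pos: "0 < D" "0 < N" "0 < N - 2"
    using assms by (simp_all add: N_def D_def)
  have D1: "D - N + 1 = (real d - 1) * (real e - 1)"
    by (simp add: N_def D_def algebra_simps)
  then have "0 < D - N + 1" using assms by simp
  have p: "D - N * real j + (real j)\<^sup>2 = (real d - real j) * (real e - real j)"
    by (simp add: N_def D_def algebra_simps power2_eq_square)
  have "N * ((real d - real j) * (real e - real j) * g (real j) + (real j)\<^sup>2 * g (real j - 1))
      \<le> (D - N + 1) * (N - 2) * (N\<^sup>2 + (N * real j - D)\<^sup>2)"
    using crude_defect_nonneg[of d e j] assms(3-)
    unfolding crude_defect_def p[unfolded N_def D_def] g_def N_def D_def by linarith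
  then have "((real d - real j) * (real e - real j) * g (real j) + (real j)\<^sup>2 * g (real j - 1)) * (2 * N)
      \<le> (N\<^sup>2 + (N * real j - D)\<^sup>2) * (2 * (D - N + 1) * (N - 2))"
    by (simp only: mult_ac mult_le_cancel_left_pos zero_less_numeral)
  then have "((real d - real j) * (real e - real j) * g (real j) + (real j)\<^sup>2 * g (real j - 1))
        / (2 * (D - N + 1) * (N - 2)) \<le> (N\<^sup>2 + (N * real j - D)\<^sup>2) / (2 * N)"
    using pos \<open>0 < D - N + 1\<close> by (subst frac_le_iff) auto
  then show ?thesis
    using pos unfolding crude_bound_def[of "N - 2"] g_def[symmetric]
    by (subst mult_crude_bound) (auto simp only: add_divide_distrib times_divide_eq_right)
qed

lemma abs_eberlein_Suc_le:
  assumes "\<And>m. \<bar>eberlein d e m i\<bar> \<le> f (real m) * eberlein d e m 0"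
  shows "real (Suc d) * real (Suc e) * \<bar>eberlein (Suc d) (Suc e) j (Suc i)\<bar>
    \<le> ((real (Suc d) - real j) * (real (Suc e) - real j) * f (real j) + (real j)\<^sup>2 * f (real j - 1))
        * eberlein (Suc d) (Suc e) j 0"
proof (cases j)
  case 0
  \<comment> \<open>The recursion does not reach \<open>j = 0\<close>; there the hypothesis at
    \<open>m = 0\<close> says \<open>1 <= f 0\<close>.\<close>
  have "real (Suc d) * real (Suc e) * 1 \<le> real (Suc d) * real (Suc e) * f 0"
    using assms[of 0] by (intro mult_left_mono) auto
  then show ?thesis
    using 0 by simp
next
  case (Suc m)
  have "\<bar>eberlein (Suc d) (Suc e) j (Suc i)\<bar>
      \<le> f (real j) * eberlein d e j 0 + f (real m) * eberlein d e m 0"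
    using assms[of j] assms[of m] unfolding Suc eberlein_Suc by linarith
  then have "real (Suc d) * real (Suc e) * \<bar>eberlein (Suc d) (Suc e) j (Suc i)\<bar>
      \<le> real (Suc d) * real (Suc e) * (f (real j) * eberlein d e j 0 + f (real m) * eberlein d e m 0)"
    by (intro mult_left_mono) auto
  also have "\<dots> = f (real j) * (real (Suc d) * real (Suc e) * eberlein d e j 0)
      + f (real m) * (real (Suc d) * real (Suc e) * eberlein d e m 0)"
    by (simp only: distrib_left mult_ac)
  also have "\<dots> = ((real (Suc d) - real j) * (real (Suc e) - real j) * f (real j)
      + (real j)\<^sup>2 * f (real j - 1)) * eberlein (Suc d) (Suc e) j 0"
    unfolding eberlein_0_pred[of d e j] eberlein_0_pred_pred[of d e m]
    using Suc by (simp add: distrib_right distrib_left mult_ac)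
  finally show ?thesis .
qed

text \<open>A separate start of the induction, because \<open>crude_bound_step\<close> assumes
  \<open>3 <= d\<close>. For \<open>d = i = 2\<close> only the summand \<open>h = j\<close>
  survives, so the eigenvalues are 1, -2, 1.\<close>

lemma abs_eberlein_2_le_crude_bound:
  assumes "2 \<le> e" "j \<le> 2"
  shows "\<bar>eberlein 2 e j 2\<bar> \<le> crude_bound (2 + real e) (2 * real e) (real j) * eberlein 2 e j 0"
proof -
  have e: "0 < 2 + real e" "0 < 2 * real e" "2 \<le> real e" using assms by auto
  have "j = 0 \<or> j = 1 \<or> j = 2" using assms by auto
  then show ?thesis
  proof (elim disjE)
    assume "j = 0"
    then show ?thesis
      using abs_le_crude_bound[OF e(1,2), of 0] e by simp
  next
    assume [simp]: "j = 1"
    have "eberlein 2 e j 2 = - 2" "eberlein 2 e j 0 = 2 * real e"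
      by (simp_all add: eberlein_def numeral_eq_Suc)
    moreover have "4 * (2 + real e) \<le> (2 + real e)\<^sup>2 + (2 - real e)\<^sup>2"
      using mult_mono[of 2 "real e" 2 "real e"] e by (simp add: power2_eq_square algebra_simps)
    then have "2 \<le> ((2 + real e)\<^sup>2 + (2 - real e)\<^sup>2) / (2 * (2 + real e))"
      using e by (simp add: pos_le_divide_eq)
    then have "2 \<le> 2 * real e * crude_bound (2 + real e) (2 * real e) 1"
      using e by (subst mult_crude_bound) auto
    ultimately show ?thesis
      by (simp add: mult_ac)
  next
    assume [simp]: "j = 2"
    have "real (e choose 2) = real e * (real e - 1) / 2"
      using assms by (simp add: choose_two real_of_nat_div)
    then have eb: "eberlein 2 e j 2 = 1" "eberlein 2 e j 0 = real e * (real e - 1) / 2"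
      by (simp_all add: eberlein_def numeral_eq_Suc)
    have "8 * (2 + real e) \<le> ((2 + real e)\<^sup>2 + 4\<^sup>2) * (real e - 1)"
    proof -
      define x where "x = real e - 2"
      have x: "0 \<le> x" "real e = x + 2" using e by (simp_all add: x_def)
      have "((2 + real e)\<^sup>2 + 4\<^sup>2) * (real e - 1) - 8 * (2 + real e) = x^3 + 9 * x^2 + 32 * x"
        unfolding x by (simp add: algebra_simps eval_nat_numeral)
      then show ?thesis using x by (smt (verit) zero_le_power mult_nonneg_nonneg)
    qed
    then have "1 \<le> ((2 + real e)\<^sup>2 + 4\<^sup>2) / (2 * (2 + real e)) * ((real e - 1) / 4)"
      using e by (simp add: pos_le_divide_eq mult.commute)
    also have "((2 + real e)\<^sup>2 + 4\<^sup>2) / (2 * (2 + real e))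
        = 2 * real e * crude_bound (2 + real e) (2 * real e) 2"
      using e by (subst mult_crude_bound) auto
    also have "2 * real e * crude_bound (2 + real e) (2 * real e) 2 * ((real e - 1) / 4)
        = crude_bound (2 + real e) (2 * real e) 2 * (real e * (real e - 1) / 2)"
      by simp
    finally show ?thesis
      unfolding eb by simp
  qed
qed

text \<open>Induction along the recursion down to \<open>i = 1\<close> or \<open>d = 2\<close>. The
  bound covers \<open>j\<close> below the threshold as well, which is where it will be
  applied.\<close>

lemma abs_eberlein_le_crude_bound:
  assumes "0 < i" "i \<le> d" "d \<le> e"
  shows "\<bar>eberlein d e j i\<bar>
    \<le> crude_bound (real d + real e) (real d * real e) (real j) * eberlein d e j 0"
  using assms
proof (induction d arbitrary: e i j)
  case 0
  then show ?case by simp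
next
  case (Suc d)
  obtain e' where e: "e = Suc e'" using Suc.prems by (cases e) auto
  have pos: "0 < real (Suc d) * real e" "0 < real (Suc d) + real e"
    using Suc.prems by auto
  consider "Suc d < j" | "j \<le> Suc d" "i = 1" | "j \<le> Suc d" "2 \<le> i" "d = 1" | "j \<le> Suc d" "2 \<le> i" "2 \<le> d"
    using Suc.prems by linarith
  then show ?case
  proof cases
    case 1
    then show ?thesis using Suc.prems by (simp add: eberlein_eq_0)
  next
    case 2
    have "real (Suc d) * real e * \<bar>eberlein (Suc d) e j 1\<bar>
        = \<bar>real (Suc d) * real e * eberlein (Suc d) e j 1\<bar>"
      using pos by (simp add: abs_mult)
    also have "\<dots> = \<bar>real (Suc d) * real e - (real (Suc d) + real e) * real j\<bar> * eberlein (Suc d) e j 0"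
      using eberlein_1[of "Suc d" e j] eberlein_0_nonneg[of "Suc d" e j] e
      by (simp only: abs_mult abs_of_nonneg mult.commute[of "real j"])
    also have "\<dots> \<le> real (Suc d) * real e * crude_bound (real (Suc d) + real e) (real (Suc d) * real e) (real j)
        * eberlein (Suc d) e j 0"
      using pos by (intro mult_right_mono abs_le_crude_bound eberlein_0_nonneg)
    finally have "real (Suc d) * real e * \<bar>eberlein (Suc d) e j 1\<bar> \<le> real (Suc d) * real e
        * (crude_bound (real (Suc d) + real e) (real (Suc d) * real e) (real j) * eberlein (Suc d) e j 0)"
      by (simp only: mult.assoc)
    with pos(1) show ?thesis
      unfolding 2 by (rule mult_left_le_imp_le[rotated])
  next
    case 3
    then show ?thesis
      using abs_eberlein_2_le_crude_bound[of e j] Suc.prems by (auto simp: numeral_2_eq_2)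
  next
    case 4
    obtain i' where i: "i = Suc i'" "0 < i'" using 4 by (cases i) auto
    let ?N = "real (Suc d) + real e" and ?D = "real (Suc d) * real e"
    have N: "real d + real e' = ?N - 2" "real d * real e' = ?D - ?N + 1"
      by (simp_all add: e algebra_simps)
    have "\<bar>eberlein d e' m i'\<bar> \<le> crude_bound (?N - 2) (?D - ?N + 1) (real m) * eberlein d e' m 0" for m
      using Suc.IH[of i' e' m] Suc.prems i e unfolding N by simp
    from abs_eberlein_Suc_le[of d e' i' "crude_bound (?N - 2) (?D - ?N + 1)", OF this]
    have "?D * \<bar>eberlein (Suc d) e j i\<bar>
      \<le> ((real (Suc d) - real j) * (real e - real j) * crude_bound (?N - 2) (?D - ?N + 1) (real j)
         + (real j)\<^sup>2 * crude_bound (?N - 2) (?D - ?N + 1) (real j - 1)) * eberlein (Suc d) e j 0"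
      by (simp only: i e)
    also have "\<dots> \<le> (?D * crude_bound ?N ?D (real j)) * eberlein (Suc d) e j 0"
      using 4 Suc.prems by (intro mult_right_mono crude_bound_step eberlein_0_nonneg) auto
    finally have "?D * \<bar>eberlein (Suc d) e j i\<bar> \<le> ?D * (crude_bound ?N ?D (real j) * eberlein (Suc d) e j 0)"
      by (simp only: mult.assoc)
    with pos(1) show ?thesis
      by (rule mult_left_le_imp_le[rotated])
  qed
qed

section \<open>The eigenvalue at \<open>i = 2\<close> and the necessity of the threshold\<close>

text \<open>One step of the recursion, followed by \<open>eberlein_1\<close> for
  \<open>d - 1\<close> and \<open>e - 1\<close>.\<close>

lemma eberlein_2:
  fixes d e j :: nat
  defines "N \<equiv> real d + real e" and "D \<equiv> real d * real e" and "p \<equiv> (real d - real j) * (real e - real j)"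
  assumes "2 \<le> d" "2 \<le> e"
  shows "D * (D - N + 1) * eberlein d e j 2
    = (p * (D - N + 1 - real j * (N - 2)) - (real j)\<^sup>2 * (D - N + 1 - (real j - 1) * (N - 2)))
        * eberlein d e j 0"
proof -
  obtain d' e' where de: "d = Suc d'" "e = Suc e'" "0 < d'" "0 < e'"
    using assms(4,5) that[of "d - 1" "e - 1"] by simp
  have D1: "D - N + 1 = real d' * real e'" and N1: "N - 2 = real d' + real e'"
    by (simp_all add: D_def N_def de algebra_simps)
  show ?thesis
  proof (cases j)
    case 0
    then show ?thesis by (simp add: p_def D_def)
  next
    case (Suc m)
    have m: "real m = real j - 1" using Suc by simp
    have eq: "eberlein d e j 2 = eberlein d' e' j 1 - eberlein d' e' m 1"
      using eberlein_Suc[of d' e' m 1] by (simp add: de Suc numeral_2_eq_2)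
    have "D * (D - N + 1) * eberlein d e j 2
        = D * (real d' * real e' * eberlein d' e' j 1) - D * (real d' * real e' * eberlein d' e' m 1)"
      unfolding eq D1 by (simp only: right_diff_distrib mult_ac)
    also have "\<dots> = (D - N + 1 - real j * (N - 2)) * (D * eberlein d' e' j 0)
        - (D - N + 1 - (real j - 1) * (N - 2)) * (D * eberlein d' e' m 0)"
      unfolding eberlein_1[OF de(3,4)] D1 N1 m by (simp only: mult_ac)
    also have "D * eberlein d' e' j 0 = p * eberlein d e j 0"
      using eberlein_0_pred[of d' e' j] by (simp only: D_def p_def de)
    also have "D * eberlein d' e' m 0 = (real j)\<^sup>2 * eberlein d e j 0"
      using eberlein_0_pred_pred[of d' e' m] by (simp only: D_def de Suc)
    finally show ?thesis
      by (simp only: right_diff_distrib[of "eberlein d e j 0"] mult_ac)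
  qed
qed

text \<open>The difference of the two eigenvalues factors: multiplied by
  \<open>D * (D - N + 1)\<close> it is \<open>j * (N - 2) * (j * (N - 1) - D)\<close> times the
  valency, and only the last parenthesis can change sign.\<close>

lemma eberlein_1_le_eberlein_2_iff:
  fixes d e j :: nat
  assumes "2 \<le> d" "d \<le> e" "0 < j" "j \<le> d"
  shows "eberlein d e j 1 \<le> eberlein d e j 2 \<longleftrightarrow> real d * real e \<le> real j * (real d + real e - 1)"
proof -
  define N D where "N = real d + real e" and "D = real d * real e"
  define k where "k = eberlein d e j 0"
  have k: "0 < k" using assms by (simp add: k_def eberlein_0_right)
  have D1: "D - N + 1 = (real d - 1) * (real e - 1)"
    by (simp add: D_def N_def algebra_simps)
  have pos: "0 < D" "0 < D - N + 1" "0 < N - 2"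
    unfolding D1 using assms by (simp_all add: D_def N_def)
  have p: "(real d - real j) * (real e - real j) = D - N * real j + (real j)\<^sup>2"
    by (simp add: D_def N_def algebra_simps power2_eq_square)
  have "D * (D - N + 1) * (eberlein d e j 2 - eberlein d e j 1)
      = D * (D - N + 1) * eberlein d e j 2 - (D - N + 1) * (D * eberlein d e j 1)"
    by (simp only: right_diff_distrib mult_ac)
  also have "D * (D - N + 1) * eberlein d e j 2
      = ((D - N * real j + (real j)\<^sup>2) * (D - N + 1 - real j * (N - 2))
         - (real j)\<^sup>2 * (D - N + 1 - (real j - 1) * (N - 2))) * k"
    using eberlein_2[of d e j] assms by (simp only: D_def N_def p k_def)
  also have "D * eberlein d e j 1 = (D - N * real j) * k"
    using eberlein_1[of d e j] assms by (simp only: D_def N_def k_def mult.commute[of _ "real j"])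
  also have "((D - N * real j + (real j)\<^sup>2) * (D - N + 1 - real j * (N - 2))
         - (real j)\<^sup>2 * (D - N + 1 - (real j - 1) * (N - 2))) * k - (D - N + 1) * ((D - N * real j) * k)
      = (real j * (N - 2) * k) * (real j * (N - 1) - D)"
    by (simp add: algebra_simps power2_eq_square)
  finally have eq: "D * (D - N + 1) * (eberlein d e j 2 - eberlein d e j 1)
      = (real j * (N - 2) * k) * (real j * (N - 1) - D)" .
  have "eberlein d e j 1 \<le> eberlein d e j 2 \<longleftrightarrow> 0 \<le> D * (D - N
      + 1) * (eberlein d e j 2 - eberlein d e j 1)"
    using mult_le_cancel_left_pos[OF mult_pos_pos[OF pos(1,2)], of 0 "eberlein d e j 2 - eberlein d e j 1"]
    by simp
  also have "\<dots> \<longleftrightarrow> 0 \<le> real j * (N - 1) - D"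
    unfolding eq using mult_le_cancel_left_pos[of "real j * (N - 2) * k" 0 "real j * (N - 1) - D"] pos k assms
    by simp
  finally show ?thesis by (simp add: N_def D_def)
qed

text \<open>Two steps down from \<open>i = 2\<close> lead to \<open>i = 0\<close>, where the crude
  bound does not apply, so this case is computed. By \<open>eberlein_2\<close> the claim amounts to
  \<open>|X| <= (x + t) * (D - N + 1)\<close>, where \<open>x + t = j * N - D\<close>.\<close>

lemma abs_eberlein_2_le:
  fixes d e j :: nat
  defines "N \<equiv> real d + real e" and "D \<equiv> real d * real e"
  assumes "2 \<le> d" "d \<le> e" "j \<le> d" "0 \<le> t" "t \<le> 2 * real j - 3" and t: "t = real j * (N - 1) - D"
  shows "D * \<bar>eberlein d e j 2\<bar> \<le> (real j * N - D) * eberlein d e j 0"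
proof -
  define x where "x = real j"
  define p where "p = x * (x - 1) - t"
  have p: "p = (real d - real j) * (real e - real j)"
    by (simp add: p_def x_def t N_def D_def algebra_simps)
  have x: "3 / 2 \<le> x" "2 * x \<le> N"
    using assms by (simp_all add: x_def N_def)
  then have x2: "2 \<le> x" by (simp add: x_def)
  have D1: "D - N + 1 = (x - 1) * (N - 1) - t" by (simp add: t x_def algebra_simps)
  have "D - N + 1 = (real d - 1) * (real e - 1)" by (simp add: N_def D_def algebra_simps)
  then have D1pos: "0 < D - N + 1" using assms by simp
  have "0 \<le> p" unfolding p using assms by simp
  have N3: "(x - 1) * (2 * x - 3) \<le> (x - 1) * (N - 3)"
    using x x2 by (intro mult_left_mono) auto
  define X where "X = p * (N - 1 - x + t) + x\<^sup>2 * (x - 1 - t)"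
  have eq: "D * (D - N + 1) * eberlein d e j 2 = - X * eberlein d e j 0"
  proof -
    have "D * (D - N + 1) * eberlein d e j 2
      = (p * (D - N + 1 - x * (N - 2)) - x\<^sup>2 * (D - N + 1 - (x - 1) * (N - 2))) * eberlein d e j 0"
      using eberlein_2[of d e j] assms(3,4) by (simp add: p N_def D_def x_def)
    also have "p * (D - N + 1 - x * (N - 2)) - x\<^sup>2 * (D - N + 1 - (x - 1) * (N - 2)) = - X"
      unfolding D1 X_def by (simp add: algebra_simps power2_eq_square)
    finally show ?thesis .
  qed
  have "(x + t) * (D - N + 1) - X = t * x * (N - 2)"
    unfolding D1 X_def p_def by (simp add: algebra_simps power2_eq_square)
  moreover have "0 \<le> t * x * (N - 2)" using assms(6) x x2 by simp
  ultimately have up: "X \<le> (x + t) * (D - N + 1)" by linarith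
  have low: "- X \<le> (x + t) * (D - N + 1)"
  proof (cases "t \<le> x - 1")
    case True
    then have "0 \<le> X" using \<open>0 \<le> p\<close> assms(6) x x2 by (simp add: X_def)
    moreover have "0 \<le> (x + t) * (D - N + 1)" using D1pos assms(6) x2 by simp
    ultimately show ?thesis by linarith
  next
    case False
    \<comment> \<open>Here \<open>x^2 * (x - 1 - t)\<close> is the only negative part of
      \<open>X\<close>. Since \<open>t <= 2 * x - 3\<close>, its size is at most
      \<open>x^2 * (x - 2)\<close>, which the lower bound for \<open>D - N + 1\<close>
      absorbs.\<close>
    have "(x - 1) * (2 * x - 3) \<le> D - N + 1"
      using N3 assms(7) x2 unfolding D1 x_def[symmetric] by (simp add: algebra_simps)
    then have "(2 * x - 1) * ((x - 1) * (2 * x - 3)) \<le> (x + t) * (D - N + 1)"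
      using False x2 by (intro mult_mono) auto
    moreover have "x\<^sup>2 * (t - (x - 1)) \<le> x\<^sup>2 * (x - 2)"
      using assms(7) by (intro mult_left_mono) (auto simp: x_def)
    moreover have "x\<^sup>2 * (x - 2) \<le> (2 * x - 1) * ((x - 1) * (2 * x - 3))"
    proof -
      define y where "y = x - 2"
      have y: "0 \<le> y" "x = 2 + y" using x2 by (simp_all add: y_def)
      have "(2 * x - 1) * ((x - 1) * (2 * x - 3)) - x\<^sup>2 * (x - 2) = 3 * y^3 + 8 * y^2 + 7 * y + 3"
        unfolding y by (simp add: algebra_simps eval_nat_numeral)
      then show ?thesis using y by (smt (verit) zero_le_power mult_nonneg_nonneg)
    qed
    moreover have "0 \<le> p * (N - 1 - x + t)" using \<open>0 \<le> p\<close> x x2 assms(6) by simp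
    ultimately show ?thesis unfolding X_def by (simp add: algebra_simps)
  qed
  have "D * (D - N + 1) * \<bar>eberlein d e j 2\<bar> = \<bar>D * (D - N + 1) * eberlein d e j 2\<bar>"
    using D1pos by (simp add: abs_mult D_def)
  also have "\<dots> = \<bar>X\<bar> * eberlein d e j 0"
    unfolding eq by (simp add: abs_mult eberlein_0_nonneg)
  also have "\<dots> \<le> (x + t) * (D - N + 1) * eberlein d e j 0"
    using up low by (intro mult_right_mono eberlein_0_nonneg) linarith
  finally have "(D - N + 1) * (D * \<bar>eberlein d e j 2\<bar>) \<le> (D - N + 1) * ((x + t) * eberlein d e j 0)"
    by (simp only: mult_ac)
  with D1pos have "D * \<bar>eberlein d e j 2\<bar> \<le> (x + t) * eberlein d e j 0"
    by (rule mult_left_le_imp_le[rotated])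
  also have "x + t = real j * N - D" by (simp add: x_def t algebra_simps)
  finally show ?thesis .
qed

section \<open>Two steps down the recursion\<close>

text \<open>The recursion applied twice is a second difference in \<open>j\<close>; the weights are
  products of the one-step weights. Lowering \<open>d\<close>, \<open>e\<close> and \<open>j\<close>
  together leaves \<open>p\<close> unchanged, so \<open>p\<close> recurs in the middle
  weight.\<close>

lemma abs_eberlein_Suc_Suc_le:
  fixes d e j :: nat
  defines "N \<equiv> real (Suc (Suc d)) + real (Suc (Suc e))" and "D \<equiv> real (Suc (Suc d)) * real (Suc (Suc e))"
  defines "p \<equiv> (real (Suc (Suc d)) - real j) * (real (Suc (Suc e)) - real j)"
  assumes "2 \<le> j" "\<And>m. \<bar>eberlein d e m i\<bar> \<le> f (real m) * eberlein d e m 0"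
  shows "D * (D - N + 1) * \<bar>eberlein (Suc (Suc d)) (Suc (Suc e)) j (Suc (Suc i))\<bar>
    \<le> (p * (p - N + 2 * real j + 1) * f (real j) + 2 * p * (real j)\<^sup>2 * f (real j - 1)
        + (real j)\<^sup>2 * (real j - 1)\<^sup>2 * f (real j - 2)) * eberlein (Suc (Suc d)) (Suc (Suc e)) j 0"
proof -
  obtain m where j: "j = Suc (Suc m)" using assms(4) by (metis le_Suc_ex add_2_eq_Suc)
  let ?k = "eberlein (Suc (Suc d)) (Suc (Suc e)) j 0"
  have D1: "D - N + 1 = real (Suc d) * real (Suc e)"
    by (simp add: N_def D_def algebra_simps)
  have p1: "(real (Suc d) - real j) * (real (Suc e) - real j) = p - N + 2 * real j + 1"
    by (simp add: p_def N_def algebra_simps)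
  have p2: "(real (Suc d) - real (Suc m)) * (real (Suc e) - real (Suc m)) = p"
    by (simp add: p_def j)
  have A: "D * eberlein (Suc d) (Suc e) j 0 = p * ?k"
    unfolding D_def p_def by (rule eberlein_0_pred)
  have B: "D * eberlein (Suc d) (Suc e) (Suc m) 0 = (real j)\<^sup>2 * ?k"
    unfolding D_def j by (rule eberlein_0_pred_pred)
  have k0: "D * (D - N + 1) * eberlein d e j 0 = p * (p - N + 2 * real j + 1) * ?k"
  proof -
    have "D * (D - N + 1) * eberlein d e j 0 = D * (real (Suc d) * real (Suc e) * eberlein d e j 0)"
      by (simp only: D1 mult_ac)
    also have "\<dots> = (p - N + 2 * real j + 1) * (D * eberlein (Suc d) (Suc e) j 0)"
      unfolding eberlein_0_pred p1 by (simp only: mult_ac)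
    finally show ?thesis unfolding A by (simp only: mult_ac)
  qed
  have k1: "D * (D - N + 1) * eberlein d e (Suc m) 0 = p * (real j)\<^sup>2 * ?k"
  proof -
    have "D * (D - N + 1) * eberlein d e (Suc m) 0 = D * (real (Suc d) * real (Suc e) * eberlein d e (Suc m) 0)"
      by (simp only: D1 mult_ac)
    also have "\<dots> = p * (D * eberlein (Suc d) (Suc e) (Suc m) 0)"
      unfolding eberlein_0_pred p2 by (simp only: mult_ac)
    finally show ?thesis unfolding B by (simp only: mult_ac)
  qed
  have k2: "D * (D - N + 1) * eberlein d e m 0 = (real j)\<^sup>2 * (real j - 1)\<^sup>2 * ?k"
  proof -
    have "D * (D - N + 1) * eberlein d e m 0 = D * (real (Suc d) * real (Suc e) * eberlein d e m 0)"
      by (simp only: D1 mult_ac)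
    also have "\<dots> = (real (Suc m))\<^sup>2 * (D * eberlein (Suc d) (Suc e) (Suc m) 0)"
      unfolding eberlein_0_pred_pred by (simp only: mult_ac)
    finally show ?thesis unfolding B by (simp add: j mult_ac)
  qed
  have "eberlein (Suc (Suc d)) (Suc (Suc e)) j (Suc (Suc i))
      = eberlein d e j i - 2 * eberlein d e (Suc m) i + eberlein d e m i"
    unfolding j eberlein_Suc by simp
  then have "\<bar>eberlein (Suc (Suc d)) (Suc (Suc e)) j (Suc (Suc i))\<bar>
      \<le> f (real j) * eberlein d e j 0 + 2 * (f (real (Suc m)) * eberlein d e (Suc m) 0)
        + f (real m) * eberlein d e m 0"
    using assms(5)[of j] assms(5)[of "Suc m"] assms(5)[of m] by linarith
  then have "D * (D - N + 1) * \<bar>eberlein (Suc (Suc d)) (Suc (Suc e)) j (Suc (Suc i))\<bar>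
      \<le> D * (D - N + 1) * (f (real j) * eberlein d e j 0 + 2 * (f (real (Suc m)) * eberlein d e (Suc m) 0)
        + f (real m) * eberlein d e m 0)"
    unfolding D1 by (intro mult_left_mono) (auto simp: D_def)
  also have "\<dots> = f (real j) * (D * (D - N + 1) * eberlein d e j 0)
      + 2 * (f (real (Suc m)) * (D * (D - N + 1) * eberlein d e (Suc m) 0))
      + f (real m) * (D * (D - N + 1) * eberlein d e m 0)"
    by (simp only: distrib_left mult_ac)
  also have "\<dots> = (p * (p - N + 2 * real j + 1) * f (real j) + 2 * p * (real j)\<^sup>2 * f (real j - 1)
        + (real j)\<^sup>2 * (real j - 1)\<^sup>2 * f (real j - 2)) * ?k"
  proof -
    have "real j - 1 = real (Suc m)" "real j - 2 = real m" by (simp_all add: j)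
    then show ?thesis
      unfolding k0 k1 k2 by (simp only: distrib_left distrib_right mult_ac)
  qed
  finally show ?thesis .
qed

text \<open>The nonnegativity of \<open>two_step_defect\<close> in divided form;
  \<open>N - 4\<close> and \<open>D - 2 * N + 4\<close> are the sum and the product of
  \<open>d - 2\<close> and \<open>e - 2\<close>.\<close>

lemma two_step_bound:
  fixes d e j :: nat
  defines "N \<equiv> real d + real e" and "D \<equiv> real d * real e"
    and "p \<equiv> (real d - real j) * (real e - real j)"
  assumes "4 \<le> d" "d \<le> e" "0 \<le> two_step_defect N D (real j)"
  shows "p * (p - N + 2 * real j + 1) * crude_bound (N - 4) (D - 2 * N + 4) (real j)
      + 2 * p * (real j)\<^sup>2 * crude_bound (N - 4) (D - 2 * N + 4) (real j - 1)
      + (real j)\<^sup>2 * (real j - 1)\<^sup>2 * crude_bound (N - 4) (D - 2 * N + 4) (real j - 2)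
    \<le> (D - N + 1) * (real j * N - D)"
proof -
  define g where "g x = (N - 4)\<^sup>2 + ((N - 4) * x - (D - 2 * N + 4))\<^sup>2" for x
  define S where "S = p * (p - N + 2 * real j + 1) * g (real j)
      + 2 * p * (real j)\<^sup>2 * g (real j - 1) + (real j)\<^sup>2 * (real j - 1)\<^sup>2 * g (real j - 2)"
  have p: "D - N * real j + (real j)\<^sup>2 = p"
    by (simp add: p_def N_def D_def algebra_simps power2_eq_square)
  have "D - 2 * N + 4 = (real d - 2) * (real e - 2)" by (simp add: N_def D_def algebra_simps)
  then have pos: "0 < D - 2 * N + 4" "0 < N - 4" using assms(4,5) by (simp_all add: N_def)
  have "S \<le> (D - N + 1) * (real j * N - D) * (2 * (D - 2 * N + 4) * (N - 4))"
    using assms(6) unfolding two_step_defect_def p S_def g_def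
    by (simp only: diff_ge_0_iff_ge mult_ac)
  then have "S / (2 * (D - 2 * N + 4) * (N - 4)) \<le> (D - N + 1) * (real j * N - D)"
    using pos by (simp add: pos_divide_le_eq)
  then show ?thesis
    unfolding S_def crude_bound_def g_def[symmetric] by (simp only: add_divide_distrib times_divide_eq_right)
qed

text \<open>For these \<open>t\<close> the value \<open>j - 1\<close> falls below the threshold one
  step down. The crude bound two steps down replaces the induction hypothesis; \<open>3 <= i\<close>
  keeps \<open>i - 2\<close> positive there.\<close>

lemma abs_eberlein_le_gap:
  fixes d e j i :: nat
  defines "t \<equiv> int j * (int d + int e - 1) - int d * int e"
  assumes "4 \<le> d" "d \<le> e" "j \<le> d" "3 \<le> i" "i \<le> d" "0 \<le> t" "t < 2 * (int j - 1)"
  shows "real d * real e * \<bar>eberlein d e j i\<bar>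
    \<le> (real j * (real d + real e) - real d * real e) * eberlein d e j 0"
proof -
  have "1 < int j" using assms(7,8) by presburger
  then have "2 \<le> j" by simp
  obtain d' e' i' where de: "d = Suc (Suc d')" "e = Suc (Suc e')" "i = Suc (Suc i')"
    using assms that[of "d - 2" "e - 2" "i - 2"] by simp
  define N D where "N = real d + real e" and "D = real d * real e"
  have ND: "real d' + real e' = N - 4" "real d' * real e' = D - 2 * N + 4"
    by (simp_all add: N_def D_def de algebra_simps)
  have "D - N + 1 = (real d - 1) * (real e - 1)" by (simp add: N_def D_def algebra_simps)
  then have D1: "0 < D - N + 1" using assms by simp
  have "\<bar>eberlein d' e' m i'\<bar> \<le> crude_bound (N - 4) (D - 2 * N + 4) (real m) * eberlein d' e' m 0" for m
    using abs_eberlein_le_crude_bound[of i' d' e' m] assms unfolding ND by (simp add: de)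
  from abs_eberlein_Suc_Suc_le[OF \<open>2 \<le> j\<close> this]
  have "D * (D - N + 1) * \<bar>eberlein d e j i\<bar>
    \<le> ((real d - real j) * (real e - real j) * ((real d - real j) * (real e - real j) - N + 2 * real j + 1)
        * crude_bound (N - 4) (D - 2 * N + 4) (real j)
      + 2 * ((real d - real j) * (real e - real j)) * (real j)\<^sup>2 * crude_bound (N - 4) (D - 2 * N + 4) (real j - 1)
      + (real j)\<^sup>2 * (real j - 1)\<^sup>2 * crude_bound (N - 4) (D - 2 * N + 4) (real j - 2)) * eberlein d e j 0"
    unfolding N_def D_def de .
  also have "\<dots> \<le> ((D - N + 1) * (real j * N - D)) * eberlein d e j 0"
    using two_step_bound[of d e j] two_step_defect_nonneg[of d e j] assms
    by (intro mult_right_mono eberlein_0_nonneg) (auto simp: N_def D_def)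
  finally have "(D - N + 1) * (D * \<bar>eberlein d e j i\<bar>) \<le> (D - N + 1) * ((real j * N - D) * eberlein d e j 0)"
    by (simp only: mult_ac)
  with D1 show ?thesis
    unfolding N_def D_def by (rule mult_left_le_imp_le[rotated])
qed

lemma abs_eberlein_3_le:
  assumes "e = 3 \<or> e = 4"
  shows "real 3 * real e * \<bar>eberlein 3 e 2 3\<bar> \<le> (real 2 * (real 3 + real e) - real 3 * real e) * eberlein 3 e 2 0"
  using assms by (auto simp: eberlein_def numeral_eq_Suc)

section \<open>The main induction above the threshold\<close>

text \<open>With \<open>t = j * (N - 1) - D\<close>, the assumption \<open>2 * (j - 1) <= t\<close>
  is exactly the premise of \<open>B\<close> and implies that of \<open>A\<close>. After the
  triangle inequality the two sides differ by \<open>j * (2 * p + t * (N - 2 * j))\<close> times the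
  valency.\<close>

lemma abs_eberlein_Suc_le_descent:
  fixes d e j :: nat
  defines "N \<equiv> real (Suc d) + real (Suc e)" and "D \<equiv> real (Suc d) * real (Suc e)"
  assumes "0 < d" "0 < e" "0 < j" "j \<le> Suc d" "d \<le> e" "2 * (real j - 1) \<le> real j * (N - 1) - D"
    and A: "D - N + 1 \<le> real j * (N - 3) \<Longrightarrow>
      (D - N + 1) * \<bar>eberlein d e j i\<bar> \<le> (real j * (N - 2) - (D - N + 1)) * eberlein d e j 0"
    and B: "D - N + 1 \<le> (real j - 1) * (N - 3) \<Longrightarrow>
      (D - N + 1) * \<bar>eberlein d e (j - 1) i\<bar> \<le> ((real j - 1) * (N - 2) - (D - N + 1)) * eberlein d e (j - 1) 0"
  shows "D * \<bar>eberlein (Suc d) (Suc e) j (Suc i)\<bar> \<le> (real j * N - D) * eberlein (Suc d) (Suc e) j 0"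
proof -
  obtain m where m: "j = Suc m" using assms(5) by (cases j) auto
  define p where "p = (real (Suc d) - real j) * (real (Suc e) - real j)"
  let ?k = "eberlein (Suc d) (Suc e) j 0"
  have D1: "D - N + 1 = real d * real e" by (simp add: N_def D_def algebra_simps)
  have D1pos: "0 < D - N + 1" unfolding D1 using assms by simp
  have N3: "0 \<le> N - 3" "2 * real j \<le> N" using assms by (simp_all add: N_def)
  have p: "p = D - real j * N + (real j)\<^sup>2"
    by (simp add: p_def N_def D_def algebra_simps power2_eq_square)
  have "0 \<le> p" unfolding p_def using assms by simp
  have "\<bar>eberlein (Suc d) (Suc e) j (Suc i)\<bar> \<le> \<bar>eberlein d e j i\<bar> + \<bar>eberlein d e (j - 1) i\<bar>"
    unfolding m eberlein_Suc by simp
  then have "D * ((D - N + 1) * \<bar>eberlein (Suc d) (Suc e) j (Suc i)\<bar>)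
      \<le> D * ((D - N + 1) * (\<bar>eberlein d e j i\<bar> + \<bar>eberlein d e (j - 1) i\<bar>))"
    using D1pos by (intro mult_left_mono) (auto simp: D_def)
  also have "(D - N + 1) * (\<bar>eberlein d e j i\<bar> + \<bar>eberlein d e (j - 1) i\<bar>)
      \<le> (real j * (N - 2) - (D - N + 1)) * eberlein d e j 0
        + ((real j - 1) * (N - 2) - (D - N + 1)) * eberlein d e (j - 1) 0"
    unfolding distrib_left
  proof (rule add_mono)
    show "(D - N + 1) * \<bar>eberlein d e j i\<bar> \<le> (real j * (N - 2) - (D - N + 1)) * eberlein d e j 0"
      using assms(8) N3 by (intro A) (simp add: algebra_simps)
    show "(D - N + 1) * \<bar>eberlein d e (j - 1) i\<bar> \<le> ((real j - 1) * (N - 2) - (D - N + 1)) * eberlein d e (j - 1) 0"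
      using assms(8) N3 by (intro B) (simp add: algebra_simps)
  qed
  then have "D * ((D - N + 1) * (\<bar>eberlein d e j i\<bar> + \<bar>eberlein d e (j - 1) i\<bar>))
      \<le> D * ((real j * (N - 2) - (D - N + 1)) * eberlein d e j 0
        + ((real j - 1) * (N - 2) - (D - N + 1)) * eberlein d e (j - 1) 0)"
    by (rule mult_left_mono) (simp add: D_def)
  also have "\<dots> = (real j * (N - 2) - (D - N + 1)) * (D * eberlein d e j 0)
        + ((real j - 1) * (N - 2) - (D - N + 1)) * (D * eberlein d e m 0)"
    by (simp only: distrib_left mult_ac) (simp add: m)
  also have "D * eberlein d e j 0 = p * ?k"
    unfolding D_def p_def by (rule eberlein_0_pred)
  also have "D * eberlein d e m 0 = (real j)\<^sup>2 * ?k"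
    unfolding D_def m by (rule eberlein_0_pred_pred)
  also have "(real j * (N - 2) - (D - N + 1)) * (p * ?k)
        + ((real j - 1) * (N - 2) - (D - N + 1)) * ((real j)\<^sup>2 * ?k)
      = ((real j * (N - 2) - (D - N + 1)) * p + ((real j - 1) * (N - 2) - (D - N + 1)) * (real j)\<^sup>2) * ?k"
    by (simp only: distrib_left distrib_right mult_ac)
  also have "\<dots> \<le> ((D - N + 1) * (real j * N - D)) * ?k"
  proof (intro mult_right_mono eberlein_0_nonneg)
    have "(D - N + 1) * (real j * N - D)
        - ((real j * (N - 2) - (D - N + 1)) * p + ((real j - 1) * (N - 2) - (D - N + 1)) * (real j)\<^sup>2)
      = real j * (2 * p + (real j * (N - 1) - D) * (N - 2 * real j))"
      unfolding p by (simp add: algebra_simps power2_eq_square)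
    moreover have "0 \<le> real j * (2 * p + (real j * (N - 1) - D) * (N - 2 * real j))"
      using \<open>0 \<le> p\<close> assms(5,8) N3 by (intro mult_nonneg_nonneg add_nonneg_nonneg) auto
    ultimately show "(real j * (N - 2) - (D - N + 1)) * p
          + ((real j - 1) * (N - 2) - (D - N + 1)) * (real j)\<^sup>2
        \<le> (D - N + 1) * (real j * N - D)"
      by linarith
  qed
  finally have "(D - N + 1) * (D * \<bar>eberlein (Suc d) (Suc e) j (Suc i)\<bar>) \<le> (D - N + 1) * ((real j * N - D) * ?k)"
    by (simp only: mult_ac)
  with D1pos show ?thesis
    by (rule mult_left_le_imp_le[rotated])
qed

text \<open>By \<open>eberlein_1\<close> the right-hand side is
  \<open>- d * e * eberlein d e j 1\<close>; as a multiple of the valency it is compatible with the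
  recursion. All \<open>j\<close> are allowed, because the descent lowers \<open>d\<close> while
  keeping \<open>j\<close> in one term.\<close>

lemma abs_eberlein_le:
  fixes d e j i :: nat
  assumes "0 < i" "i \<le> d" "d \<le> e" "real d * real e \<le> real j * (real d + real e - 1)"
  shows "real d * real e * \<bar>eberlein d e j i\<bar>
    \<le> (real j * (real d + real e) - real d * real e) * eberlein d e j 0"
  using assms
proof (induction d arbitrary: e i j)
  case 0
  then show ?case by simp
next
  case (Suc d)
  obtain e' where e: "e = Suc e'" "d \<le> e'" using Suc.prems by (cases e) auto
  define N D where "N = real (Suc d) + real e" and "D = real (Suc d) * real e"
  define t where "t = int j * (int (Suc d) + int e - 1) - int (Suc d) * int e"
  have t: "of_int t = real j * (N - 1) - D" by (simp add: t_def N_def D_def)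
  have t0: "0 \<le> t" using Suc.prems(4) t unfolding N_def D_def by linarith
  have j: "0 < j"
  proof (rule gr0I)
    assume "j = 0"
    moreover have "0 < real (Suc d) * real e" using e by simp
    ultimately show False using Suc.prems(4) by simp
  qed
  consider "Suc d < j" | "j \<le> Suc d" "i = 1"
    | "j \<le> Suc d" "2 \<le> i" "2 * (int j - 1) \<le> t"
    | "j \<le> Suc d" "2 \<le> i" "t < 2 * (int j - 1)"
    using Suc.prems by linarith
  then show ?case
  proof cases
    case 1
    then show ?thesis using Suc.prems by (simp add: eberlein_eq_0)
  next
    case 2
    have "real j * N - D \<ge> 0" using Suc.prems(4) by (simp add: N_def D_def algebra_simps)
    have "D * \<bar>eberlein (Suc d) e j 1\<bar> = \<bar>D * eberlein (Suc d) e j 1\<bar>"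
      by (simp add: abs_mult D_def)
    also have "\<dots> = \<bar>D - real j * N\<bar> * eberlein (Suc d) e j 0"
      using eberlein_1[of "Suc d" e j] e eberlein_0_nonneg[of "Suc d" e j]
      by (simp only: D_def N_def abs_mult abs_of_nonneg)
    also have "\<bar>D - real j * N\<bar> = real j * N - D"
      using \<open>real j * N - D \<ge> 0\<close> by simp
    finally show ?thesis unfolding 2 D_def N_def by simp
  next
    case 3
    obtain i' where i: "i = Suc i'" "0 < i'" "i' \<le> d" using 3 Suc.prems by (cases i) auto
    have ND: "real d + real e' = N - 2" "real d * real e' = D - N + 1"
      by (simp_all add: N_def D_def e algebra_simps)
    have "of_int (2 * (int j - 1)) \<le> (of_int t :: real)"
      using 3(3) by (simp only: of_int_le_iff)
    then have "2 * (real j - 1) \<le> real j * (N - 1) - D"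
      unfolding t by simp
    moreover have "(D - N + 1) * \<bar>eberlein d e' j i'\<bar> \<le> (real j * (N - 2) - (D - N + 1)) * eberlein d e' j 0"
      if "D - N + 1 \<le> real j * (N - 3)"
      using Suc.IH[of i' e' j] i e that unfolding ND by (simp add: algebra_simps)
    moreover have "(D - N + 1) * \<bar>eberlein d e' (j - 1) i'\<bar>
        \<le> ((real j - 1) * (N - 2) - (D - N + 1)) * eberlein d e' (j - 1) 0"
      if "D - N + 1 \<le> (real j - 1) * (N - 3)"
    proof -
      have "real (j - 1) = real j - 1" using j by simp
      then show ?thesis
        using Suc.IH[of i' e' "j - 1"] i e that unfolding ND by (simp add: algebra_simps)
    qed
    ultimately show ?thesis
      using abs_eberlein_Suc_le_descent[of d e' j i'] i e j 3 unfolding N_def D_def by simp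
  next
    case 4
    consider "i = 2" | "3 \<le> i" "4 \<le> Suc d" | "i = 3" "d = 2"
      using 4 Suc.prems by linarith
    then show ?thesis
    proof cases
      case 1
      have "t \<le> 2 * int j - 3" using 4 by presburger
      then have "of_int t \<le> (of_int (2 * int j - 3) :: real)" by (simp only: of_int_le_iff)
      then show ?thesis
        using abs_eberlein_2_le[of "Suc d" e j "of_int t"] 1 4 t0 t Suc.prems by (simp add: N_def D_def)
    next
      case 2
      then show ?thesis
        using abs_eberlein_le_gap[of "Suc d" e j i] 4 t0 Suc.prems unfolding t_def by simp
    next
      case 3
      \<comment> \<open>The only gap case with \<open>3 <= i\<close> and \<open>Suc d < 4\<close>.
        Here \<open>j = 1\<close> makes \<open>t\<close> negative, \<open>j = 3\<close> gives
        \<open>t = 6\<close>, and \<open>j = 2\<close> gives \<open>t = 4 - e\<close>, which leaves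
        two values of \<open>e\<close>.\<close>
      have "j = 1 \<or> j = 2 \<or> j = 3" using 3 4 j by auto
      then have "j = 2 \<and> (e = 3 \<or> e = 4)"
        using 3 4 t0 Suc.prems unfolding t_def by (elim disjE) auto
      then show ?thesis
        using abs_eberlein_3_le[of e] 3 by (simp add: numeral_3_eq_3)
    qed
  qed
qed

lemma abs_eberlein_le_abs_eberlein_1:
  fixes d e j i :: nat
  assumes "0 < i" "i \<le> d" "d \<le> e" "real d * real e \<le> real j * (real d + real e - 1)"
  shows "\<bar>eberlein d e j i\<bar> \<le> - eberlein d e j 1"
proof -
  have pos: "0 < real d * real e" using assms by simp
  have "real d * real e * \<bar>eberlein d e j i\<bar> \<le> real d * real e * - eberlein d e j 1"
    using abs_eberlein_le[OF assms] eberlein_1[of d e j] assms by (simp add: algebra_simps)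
  with pos show ?thesis by (rule mult_left_le_imp_le[rotated])
qed

text \<open>Necessity compares \<open>i = 1\<close> with \<open>i = 2\<close>. For
  \<open>d = 1\<close> there is no \<open>i = 2\<close>, but then \<open>j = 1\<close> and both
  sides of the threshold inequality equal \<open>e\<close>.\<close>

lemma eberlein_1_minimal_iff:
  assumes "d \<le> e" "0 < j" "j \<le> d"
  shows "(\<forall>i\<in>{0..d}. eberlein d e j 1 \<le> eberlein d e j i)
    \<longleftrightarrow> real d * real e \<le> real j * (real d + real e - 1)"
proof
  assume *: "\<forall>i\<in>{0..d}. eberlein d e j 1 \<le> eberlein d e j i"
  show "real d * real e \<le> real j * (real d + real e - 1)"
  proof (cases "d = 1")
    case True
    then show ?thesis using assms by simp
  next
    case False
    then have "2 \<le> d" using assms by simp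
    then show ?thesis
      using * eberlein_1_le_eberlein_2_iff[of d e j] assms by simp
  qed
next
  assume *: "real d * real e \<le> real j * (real d + real e - 1)"
  show "\<forall>i\<in>{0..d}. eberlein d e j 1 \<le> eberlein d e j i"
  proof
    fix i assume i: "i \<in> {0..d}"
    have "\<bar>eberlein d e j 1\<bar> \<le> - eberlein d e j 1"
      using abs_eberlein_le_abs_eberlein_1[of 1 d e j] assms * by simp
    show "eberlein d e j 1 \<le> eberlein d e j i"
    proof (cases "i = 0")
      case True
      then show ?thesis
        using \<open>\<bar>eberlein d e j 1\<bar> \<le> - eberlein d e j 1\<close> eberlein_0_nonneg[of d e j] by simp
    next
      case False
      then show ?thesis
        using abs_eberlein_le_abs_eberlein_1[of i d e j] assms * i by simp
    qed
  qed
qed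

section \<open>The spectrum of the Johnson graph\<close>

text \<open>Replaces vectors indexed by the chosen enumeration by functions on the vertices, so that
  the combinatorics below is free of indices.\<close>

lemma graph_spectrum_iff:
  assumes "finite (pverts G)"
  shows "\<mu> \<in> graph_spectrum G \<longleftrightarrow> (\<exists>f. (\<exists>x\<in>pverts G. f x \<noteq> 0) \<and>
    (\<forall>x\<in>pverts G. (\<Sum>y | y \<in> pverts G \<and> (x, y) \<in> parcs G. f y) = \<mu> * f x))"
proof -
  define vs where "vs = vertex_list G"
  define n where "n = length vs"
  define A where "A = adjacency_matrix G"
  obtain us where "distinct us \<and> set us = pverts G"
    using finite_distinct_list[OF assms] by blast
  then have "distinct vs \<and> set vs = pverts G"
    unfolding vs_def vertex_list_def by (rule someI)
  then have vs: "distinct vs" "pverts G = set vs" by auto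
  have A: "A = mat n n (\<lambda>(a, b). if (vs ! a, vs ! b) \<in> parcs G then 1 else 0)"
    by (simp add: A_def adjacency_matrix_def vs_def n_def Let_def)
  have mult: "(A *\<^sub>v vec n (\<lambda>i. f (vs ! i))) $ i
      = (\<Sum>y | y \<in> pverts G \<and> (vs ! i, y) \<in> parcs G. f y)" if "i < n" for f i
  proof -
    have "(A *\<^sub>v vec n (\<lambda>i. f (vs ! i))) $ i
        = (\<Sum>k<n. if (vs ! i, vs ! k) \<in> parcs G then f (vs ! k) else 0)"
      using that by (auto simp: A scalar_prod_def lessThan_atLeast0 intro!: sum.cong)
    also have "\<dots> = (\<Sum>y\<in>set vs. if (vs ! i, y) \<in> parcs G then f y else 0)"
      unfolding n_def by (rule sum.reindex_bij_betw[OF bij_betw_nth[OF vs(1)]]) auto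
    also have "\<dots> = (\<Sum>y | y \<in> pverts G \<and> (vs ! i, y) \<in> parcs G. f y)"
      by (simp add: vs(2) sum.If_cases Int_def)
    finally show ?thesis .
  qed
  have ev: "eigenvector A (vec n (\<lambda>i. f (vs ! i))) \<mu> \<longleftrightarrow> (\<exists>x\<in>pverts G. f x \<noteq> 0) \<and>
      (\<forall>x\<in>pverts G. (\<Sum>y | y \<in> pverts G \<and> (x, y) \<in> parcs G. f y) = \<mu> * f x)" for f
  proof -
    have "vec n (\<lambda>i. f (vs ! i)) \<noteq> 0\<^sub>v n \<longleftrightarrow> (\<exists>x\<in>pverts G. f x \<noteq> 0)"
      unfolding vs(2) by (auto simp: vec_eq_iff n_def set_conv_nth)
    moreover have "A *\<^sub>v vec n (\<lambda>i. f (vs ! i)) = \<mu> \<cdot>\<^sub>v vec n (\<lambda>i. f (vs ! i)) \<longleftrightarrow>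
      (\<forall>i<n. (A *\<^sub>v vec n (\<lambda>i. f (vs ! i))) $ i = \<mu> * f (vs ! i))"
      by (auto simp: vec_eq_iff A)
    moreover have "\<dots> \<longleftrightarrow> (\<forall>x\<in>pverts G. (\<Sum>y | y \<in> pverts G \<and> (x, y) \<in> parcs G. f y) = \<mu> * f x)"
      using mult unfolding vs(2) by (auto simp: n_def all_set_conv_all_nth)
    ultimately show ?thesis
      unfolding eigenvector_def by (simp add: A)
  qed
  \<comment> \<open>Every vector comes from a function: \<open>inv_into\<close> looks up the index
    of a vertex, which is unique because \<open>vs\<close> is distinct.\<close>
  have inv: "v = vec n (\<lambda>i. (v $ inv_into {..<n} ((!) vs) (vs ! i)))" if "v \<in> carrier_vec n" for v
    using that by (auto simp: vec_eq_iff n_def inv_into_f_f[OF inj_on_nth[OF vs(1)]])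
  have ex: "\<exists>f. v = vec n (\<lambda>i. f (vs ! i))" if "v \<in> carrier_vec n" for v
    using inv[OF that] by (rule exI[where x = "\<lambda>x. v $ inv_into {..<n} ((!) vs) x"])
  have "(\<exists>v. eigenvector A v \<mu>) \<longleftrightarrow> (\<exists>f. eigenvector A (vec n (\<lambda>i. f (vs ! i))) \<mu>)"
  proof (intro iffI; elim exE)
    fix v assume v: "eigenvector A v \<mu>"
    then have "v \<in> carrier_vec n" unfolding eigenvector_def by (simp add: A)
    from ex[OF this] obtain f where f: "v = vec n (\<lambda>i. f (vs ! i))" by (elim exE)
    from v show "\<exists>f. eigenvector A (vec n (\<lambda>i. f (vs ! i))) \<mu>" unfolding f by (rule exI[of _ f])
  next
    fix f assume "eigenvector A (vec n (\<lambda>i. f (vs ! i))) \<mu>"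
    then show "\<exists>v. eigenvector A v \<mu>" by (rule exI)
  qed
  then show ?thesis
    unfolding graph_spectrum_def spectrum_def eigenvalue_def A_def[symmetric] mem_Collect_eq ev .
qed

section \<open>Neighbourhoods in the Johnson graph\<close>

lemma card_subsets_split:
  assumes "finite X" "Y \<subseteq> X"
  shows "card {U. U \<subseteq> X \<and> card (U \<inter> Y) = a \<and> card (U
      - Y) = b} = (card Y choose a) * (card (X - Y) choose b)"
proof -
  let ?P = "{A. A \<subseteq> Y \<and> card A = a} \<times> {B. B \<subseteq> X - Y \<and> card B = b}"
  have "bij_betw (\<lambda>(A, B). A \<union> B) ?P {U. U \<subseteq> X \<and> card (U \<inter> Y) = a \<and> card (U - Y) = b}"
  proof (rule bij_betwI[where g = "\<lambda>U. (U \<inter> Y, U - Y)"])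
    have *: "(A \<union> B) \<inter> Y = A" "(A \<union> B) - Y = B" if "A \<subseteq> Y" "B \<subseteq> X - Y" for A B
      using that by auto
    show "(\<lambda>(A, B). A \<union> B) \<in> ?P \<rightarrow> {U. U \<subseteq> X \<and> card (U \<inter> Y) = a \<and> card (U - Y) = b}"
      using * assms(2) by auto
    show "(\<lambda>U. (U \<inter> Y, U - Y)) ((\<lambda>(A, B). A \<union> B) x) = x" if "x \<in> ?P" for x
      using that * by auto
  qed (use assms(2) in auto)
  then have "card {U. U \<subseteq> X \<and> card (U \<inter> Y) = a \<and> card (U - Y) = b} = card ?P"
    by (rule bij_betw_same_card[symmetric])
  also have "\<dots> = (card Y choose a) * (card (X - Y) choose b)"
    using assms by (simp add: card_cartesian_product n_subsets finite_subset)
  finally show ?thesis .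
qed

text \<open>For \<open>j <= d\<close> this is adjacency, by \<open>nbrs_eq\<close>. Phrased with
  \<open>card (T - S)\<close>, it avoids the truncated \<open>d - j\<close> when the induction
  reaches \<open>j > d\<close>.\<close>

definition nbrs :: "'a set \<Rightarrow> nat \<Rightarrow> nat \<Rightarrow> 'a set \<Rightarrow> 'a set set" where
  "nbrs X d j S = {T. T \<subseteq> X \<and> card T = d \<and> card (T - S) = j}"

lemma card_nbrs:
  assumes "finite X" "S \<subseteq> X" "card S = d" "card X = d + e"
  shows "card (nbrs X d j S) = (d choose j) * (e choose j)"
proof (cases "j \<le> d")
  case True
  have "nbrs X d j S = {T. T \<subseteq> X \<and> card (T \<inter> S) = d - j \<and> card (T - S) = j}"
  proof -
    have "card T = card (T \<inter> S) + card (T - S)" if "T \<subseteq> X" for T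
      using that assms(1) card_Int_Diff[of T S] by (simp add: finite_subset)
    then show ?thesis unfolding nbrs_def using True by auto
  qed
  then have "card (nbrs X d j S) = (card S choose (d - j)) * (card (X - S) choose j)"
    using card_subsets_split[OF assms(1,2)] by simp
  also have "card (X - S) = e"
    using assms by (simp add: card_Diff_subset finite_subset)
  finally show ?thesis
    using True assms(3) binomial_symmetric[of j d] by simp
next
  case False
  have "card (T - S) \<le> card T" if "T \<subseteq> X" for T
    using that assms(1) by (meson card_Diff_subset_Int Diff_subset card_mono finite_subset)
  then have "nbrs X d j S = {}" unfolding nbrs_def using False by force
  then show ?thesis using False by simp
qed

lemma nbrs_eq:
  assumes "finite X" "S \<subseteq> X" "card S = d" "j \<le> d"
  shows "nbrs X d j S = {T. T \<subseteq> X \<and> card T = d \<and> card (S \<inter> T) = d - j}"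
proof -
  have "card (T - S) = j \<longleftrightarrow> card (S \<inter> T) = d - j" if "T \<subseteq> X" "card T = d" for T
  proof -
    have "d = card (S \<inter> T) + card (T - S)"
      using that assms(1) card_Int_Diff[of T S] by (simp add: finite_subset Int_commute)
    then show ?thesis using assms(4) by arith
  qed
  then show ?thesis unfolding nbrs_def by blast
qed

section \<open>Each \<open>eberlein d e j i\<close> is an eigenvalue\<close>

text \<open>For \<open>i\<close> disjoint pairs these products generate the copy of the Specht
  module of shape \<open>(n - i, i)\<close> inside the functions on \<open>d\<close>-sets.\<close>

fun specht :: "('a \<times> 'a) list \<Rightarrow> 'a set \<Rightarrow> real" where
  "specht [] T = 1"
| "specht ((a, b) # ps) T = (of_bool (a \<in> T) - of_bool (b \<in> T)) * specht ps T"

lemma specht_insert: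
  "x \<notin> fst ` set ps \<Longrightarrow> x \<notin> snd ` set ps \<Longrightarrow> specht ps (insert x T) = specht ps T"
  by (induction ps T rule: specht.induct) auto

lemma sum_insert_nbrs:
  assumes "finite X" "a \<notin> X" "b \<notin> X" "a \<noteq> b" "a \<notin> fst ` set ps" "a \<notin> snd ` set ps"
  shows "(\<Sum>T | T \<in> nbrs (insert a (insert b X)) (Suc d) j S \<and> a \<in> T \<and> b \<notin> T. specht ps T)
    = (\<Sum>U | U \<subseteq> X \<and> card U = d \<and> card (insert a U - S) = j. specht ps U)"
proof (rule sum.reindex_bij_witness[where i = "insert a" and j = "\<lambda>T. T - {a}"])
  fix T assume T: "T \<in> {T \<in> nbrs (insert a (insert b X)) (Suc d) j S. a \<in> T \<and> b \<notin> T}"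
  then show "insert a (T - {a}) = T" by auto
  have "finite T" using T assms(1) by (auto simp: nbrs_def intro: finite_subset)
  then have "card (T - {a}) = d" using T by (auto simp: nbrs_def)
  then show "T - {a} \<in> {U. U \<subseteq> X \<and> card U = d \<and> card (insert a U - S) = j}"
    using T by (auto simp: nbrs_def insert_absorb)
  show "specht ps (T - {a}) = specht ps T"
    using specht_insert[of a ps "T - {a}"] assms T by (simp add: insert_absorb)
next
  fix U assume U: "U \<in> {U. U \<subseteq> X \<and> card U = d \<and> card (insert a U - S) = j}"
  then have "a \<notin> U" "b \<notin> U" "finite U" using assms by (auto intro: finite_subset)
  then show "insert a U
      - {a} = U" "insert a U \<in> {T \<in> nbrs (insert a (insert b X)) (Suc d) j S. a \<in> T \<and> b \<notin> T}"
    using U assms by (auto simp: nbrs_def)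
qed

text \<open>The first factor vanishes unless \<open>T\<close> contains exactly one of
  \<open>a\<close> and \<open>b\<close>; deleting that point leaves a \<open>d\<close>-subset of
  \<open>X\<close>.\<close>

lemma sum_nbrs_Cons:
  assumes "finite X" "a \<notin> X" "b \<notin> X" "a \<noteq> b"
    and "fst ` set ps \<subseteq> X" "snd ` set ps \<subseteq> X"
  shows "(\<Sum>T\<in>nbrs (insert a (insert b X)) (Suc d) j S. specht ((a, b) # ps) T)
    = (\<Sum>U | U \<subseteq> X \<and> card U = d \<and> card (insert a U - S) = j. specht ps U)
      - (\<Sum>U | U \<subseteq> X \<and> card U = d \<and> card (insert b U - S) = j. specht ps U)"
proof -
  let ?N = "nbrs (insert a (insert b X)) (Suc d) j S"
  have fin: "finite ?N"
    by (rule finite_subset[of _ "{T. T \<subseteq> insert a (insert b X)}"]) (auto simp: nbrs_def assms(1))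
  have "(\<Sum>T\<in>?N. specht ((a, b) # ps) T)
    = (\<Sum>T\<in>?N. (if a \<in> T \<and> b \<notin> T then specht ps T else 0)
        - (if b \<in> T \<and> a \<notin> T then specht ps T else 0))"
    by (rule sum.cong) auto
  also have "\<dots> = (\<Sum>T | T \<in> ?N \<and> a \<in> T \<and> b \<notin> T. specht ps T)
      - (\<Sum>T | T \<in> ?N \<and> b \<in> T \<and> a \<notin> T. specht ps T)"
    using fin by (simp add: sum_subtractf sum.inter_filter)
  also have "(\<Sum>T | T \<in> ?N \<and> a \<in> T \<and> b \<notin> T. specht ps T)
      = (\<Sum>U | U \<subseteq> X \<and> card U = d \<and> card (insert a U - S) = j. specht ps U)"
    using assms by (intro sum_insert_nbrs) auto
  also have "(\<Sum>T | T \<in> ?N \<and> b \<in> T \<and> a \<notin> T. specht ps T)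
      = (\<Sum>U | U \<subseteq> X \<and> card U = d \<and> card (insert b U - S) = j. specht ps U)"
    unfolding insert_commute[of a b] using assms by (intro sum_insert_nbrs) auto
  finally show ?thesis .
qed

lemma specht_eigenvector:
  assumes "finite X" "card X = d + e" "S \<subseteq> X" "card S = d"
    and "distinct (map fst ps @ map snd ps)" "fst ` set ps \<subseteq> X" "snd ` set ps \<subseteq> X"
    and "length ps \<le> d" "length ps \<le> e"
  shows "(\<Sum>T\<in>nbrs X d j S. specht ps T) = eberlein d e j (length ps) * specht ps S"
  using assms
proof (induction ps arbitrary: X d e j S)
  case Nil
  then show ?case by (simp add: card_nbrs eberlein_0_right)
next
  case (Cons ab ps)
  obtain a b where ab: "ab = (a, b)" by (cases ab)
  obtain d' e' where de: "d = Suc d'" "e = Suc e'" "length ps \<le> d'" "length ps \<le> e'"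
    using Cons.prems(8,9) by (cases d; cases e) auto
  define Y where "Y = X - {a, b}"
  have Y: "finite Y" "a \<notin> Y" "b \<notin> Y" "a \<noteq> b" "X = insert a (insert b Y)"
    "fst ` set ps \<subseteq> Y" "snd ` set ps \<subseteq> Y" "a \<notin> fst ` set ps" "a \<notin> snd ` set ps"
    "b \<notin> fst ` set ps" "b \<notin> snd ` set ps" "distinct (map fst ps @ map snd ps)"
    using Cons.prems unfolding Y_def ab by auto
  have cardY: "card Y = d' + e'" using Cons.prems(2) Y de by simp
  define s where "s c = (\<Sum>U | U \<subseteq> Y \<and> card U = d' \<and> card (insert c U - S) = j. specht ps U)" for c
  have sum: "(\<Sum>T\<in>nbrs X d j S. specht (ab # ps) T) = s a - s b"
    unfolding s_def Y(5) de ab by (rule sum_nbrs_Cons) (use Y in auto)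
  \<comment> \<open>Stated for \<open>c\<close> and \<open>c'\<close> to serve both orders of the
    pair. Relative to \<open>S\<close>, adding \<open>c\<close> to \<open>U\<close> creates no new
    difference, while adding \<open>c'\<close> creates one more.\<close>
  have rest: "s c - s c' = (eberlein d e j (Suc (length ps))) * specht ps S"
    if "c \<in> S" "c' \<notin> S" "S \<subseteq> insert c Y" "c \<notin> Y" "c' \<notin> Y" "c \<notin> fst ` set ps" "c \<notin> snd ` set ps" for c c'
  proof -
    define S' where "S' = S - {c}"
    have S': "S = insert c S'" "c \<notin> S'" "S' \<subseteq> Y" using that by (auto simp: S'_def)
    have "finite S'" using S'(3) Y(1) by (rule finite_subset)
    then have card: "card S' = d'" using Cons.prems(4) S' de by simp
    have IH: "(\<Sum>T\<in>nbrs Y d' m S'. specht ps T) = eberlein d' e' m (length ps) * specht ps S" for m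
      using Cons.IH[OF Y(1) cardY S'(3) card Y(12,6,7) de(3,4)] that specht_insert[of c ps S'] S' by simp
    have "insert c U - S = U - S'" "insert c' U - S = insert c' (U - S')" "c' \<notin> U - S'"
      if "U \<subseteq> Y" for U
      unfolding S'_def using that \<open>c \<in> S\<close> \<open>c \<notin> Y\<close> \<open>c' \<notin> Y\<close> \<open>c' \<notin> S\<close> by auto
    then have ins: "card (insert c U - S) = card (U - S')" "card (insert c' U - S) = Suc (card (U - S'))"
      if "U \<subseteq> Y" for U
      using that finite_subset[OF that Y(1)] by simp_all
    have sc: "s c = (\<Sum>T\<in>nbrs Y d' j S'. specht ps T)"
      unfolding s_def nbrs_def using ins by (intro sum.cong) auto
    show ?thesis
    proof (cases j)
      case 0
      have "s c' = 0"
        unfolding s_def using ins 0 by (intro sum.neutral) auto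
      then show ?thesis unfolding sc IH using 0 by simp
    next
      case (Suc m)
      have "s c' = (\<Sum>T\<in>nbrs Y d' m S'. specht ps T)"
        unfolding s_def nbrs_def using ins Suc by (intro sum.cong) auto
      then show ?thesis unfolding sc IH unfolding Suc de eberlein_Suc by (simp add: left_diff_distrib)
    qed
  qed
  show ?case
  proof (cases "a \<in> S")
    case True
    show ?thesis
    proof (cases "b \<in> S")
      case True
      have "insert a U - S = U - S" "insert b U - S = U - S" for U
        using \<open>a \<in> S\<close> \<open>b \<in> S\<close> by auto
      then have "s a = s b" unfolding s_def by simp
      then show ?thesis unfolding sum using True \<open>a \<in> S\<close> by (simp add: ab)
    next
      case False
      then show ?thesis
        unfolding sum using rest[of a b] True Cons.prems(3) Y by (auto simp: ab)
    qed
  next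
    case False
    show ?thesis
    proof (cases "b \<in> S")
      case True
      then have "s b - s a = eberlein d e j (Suc (length ps)) * specht ps S"
        using rest[of b a] False Cons.prems(3) Y by auto
      then show ?thesis unfolding sum using True False by (simp add: ab)
    next
      case False
      have "card (insert c U - S) = Suc (card (U - S))" if "c \<notin> S" "c \<notin> Y" "U \<subseteq> Y" for c U
      proof -
        have "insert c U - S = insert c (U - S)" "c \<notin> U - S" using that by auto
        then show ?thesis using finite_subset[OF that(3) Y(1)] by simp
      qed
      then have "s a = s b"
        unfolding s_def using False \<open>a \<notin> S\<close> Y(2,3) by (intro sum.cong) auto
      then show ?thesis unfolding sum using False \<open>a \<notin> S\<close> by (simp add: ab)
    qed
  qed
qed

lemma specht_eq_1:
  "(\<And>a b. (a, b) \<in> set ps \<Longrightarrow> a \<in> T \<and> b \<notin> T) \<Longrightarrow> specht ps T = 1"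
  by (induction ps T rule: specht.induct) auto

lemma eberlein_eigenvalue:
  assumes "2 * d \<le> n" "i \<le> d"
  obtains f where "f {0..<d} \<noteq> 0"
    and "\<And>S. S \<subseteq> {0..<n} \<Longrightarrow> card S = d \<Longrightarrow> (\<Sum>T\<in>nbrs {0..<n} d j S. f T) = eberlein d (n - d) j i * f S"
proof
  \<comment> \<open>The pairs are disjoint and fit into the ground set because
    \<open>d + i <= 2 * d <= n\<close>; at \<open>{0..<d}\<close> every factor equals 1.\<close>
  define ps where "ps = map (\<lambda>k. (k, d + k)) [0..<i]"
  have fst: "map fst ps = [0..<i]" and snd: "map snd ps = map (\<lambda>k. d + k) [0..<i]"
    by (simp_all add: ps_def comp_def)
  have "distinct (map fst ps @ map snd ps)"
    unfolding fst snd using assms by (auto simp: distinct_map inj_on_def)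
  moreover have "fst ` set ps \<subseteq> {0..<n}" "snd ` set ps \<subseteq> {0..<n}"
    using assms by (auto simp: ps_def)
  moreover have "length ps = i" by (simp add: ps_def)
  ultimately show "(\<Sum>T\<in>nbrs {0..<n} d j S. specht ps T) = eberlein d (n - d) j i * specht ps S"
    if "S \<subseteq> {0..<n}" "card S = d" for S
    using specht_eigenvector[of "{0..<n}" d "n - d" S ps j] that assms by simp
  show "specht ps {0..<d} \<noteq> 0"
    using assms by (subst specht_eq_1) (auto simp: ps_def)
qed

section \<open>There are no other eigenvalues\<close>

text \<open>The form in which the eigenvalue appears in the counting argument below. The right-hand
  side is shown to satisfy \<open>eberlein_Suc\<close> by applying Pascal's rule to each of its
  three binomials.\<close>

lemma eberlein_alt:
  assumes "i \<le> d" "i \<le> e"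
  shows "eberlein d e j i
    = (\<Sum>h\<le>j. (-1) ^ h * real (i choose h) * real ((d - i + h) choose j) * real ((e - h) choose (j - h)))"
  using assms
proof (induction i arbitrary: d e j)
  case 0
  have "(\<Sum>h\<le>j. (-1) ^ h * real (0 choose h) * real ((d - 0 + h) choose j) * real ((e - h) choose (j - h)))
    = (\<Sum>h\<in>{0}. (-1) ^ h * real (0 choose h) * real ((d - 0 + h) choose j) * real ((e - h) choose (j - h)))"
    by (rule sum.mono_neutral_right) auto
  then show ?case by (simp add: eberlein_0_right)
next
  case (Suc i)
  obtain d' e' where de: "d = Suc d'" "e = Suc e'" "i \<le> d'" "i \<le> e'"
    using Suc.prems by (cases d; cases e) auto
  show ?case
  proof (cases j)
    case 0
    then show ?thesis by simp
  next
    case (Suc m)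
    define c where "c h = (-1) ^ h * real (i choose h)" for h
    define x where "x h k = real ((d' - i + h) choose k)" for h k
    define y where "y h k = real ((e' - h) choose k)" for h k
    define z where "z h k = real ((Suc e' - h) choose k)" for h k
    have x: "x (Suc h) (Suc m) = x h m + x h (Suc m)" for h
      by (simp add: x_def)
    \<comment> \<open>For \<open>h > i\<close> the difference \<open>e' - h\<close> may truncate,
      but then \<open>c h = 0\<close>.\<close>
    have z: "c h * z h (Suc m - h) = c h * (y h (m - h) + y h (Suc m - h))" if "h \<le> m" for h
    proof (cases "h \<le> i")
      case True
      then have "Suc e' - h = Suc (e' - h)" "Suc m - h = Suc (m - h)" using de that by auto
      then show ?thesis by (simp add: z_def y_def)
    qed (simp add: c_def)
    have "(\<Sum>h\<le>j. (-1) ^ h * real (Suc i choose h) * real ((d - Suc i + h) choose j) * real ((e - h) choose (j - h)))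
      = (\<Sum>h\<le>Suc m. (-1) ^ h * real (Suc i choose h) * (x h (Suc m) * z h (Suc m - h)))"
      by (simp add: Suc de x_def z_def mult_ac)
    also have "\<dots> = x 0 (Suc m) * z 0 (Suc m)
        + (\<Sum>h\<le>m. (-1) ^ Suc h * real (i choose Suc h) * (x (Suc h) (Suc m) * z (Suc h) (m - h)))
        - (\<Sum>h\<le>m. c h * (x (Suc h) (Suc m) * z (Suc h) (m - h)))"
      by (subst sum.atMost_Suc_shift)
        (simp add: distrib_left distrib_right sum.distrib c_def sum_negf left_diff_distrib sum_subtractf)
    also have "x 0 (Suc m) * z 0 (Suc m)
        + (\<Sum>h\<le>m. (-1) ^ Suc h * real (i choose Suc h) * (x (Suc h) (Suc m) * z (Suc h) (m - h)))
        = (\<Sum>h\<le>Suc m. c h * (x h (Suc m) * z h (Suc m - h)))"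
      by (subst sum.atMost_Suc_shift) (simp add: c_def)
    also have "\<dots> = (\<Sum>h\<le>m. c h * (x h (Suc m) * z h (Suc m - h))) + c (Suc m) * x (Suc m) (Suc m)"
      by (simp add: z_def)
    also have "(\<Sum>h\<le>m. c h * (x h (Suc m) * z h (Suc m - h)))
        = (\<Sum>h\<le>m. c h * x h (Suc m) * y h (m - h)) + (\<Sum>h\<le>m. c h * x h (Suc m) * y h (Suc m - h))"
      unfolding sum.distrib[symmetric]
    proof (rule sum.cong)
      fix h assume "h \<in> {..m}"
      then have "c h * z h (Suc m - h) * x h (Suc m) = c h * (y h (m - h) + y h (Suc m - h)) * x h (Suc m)"
        using z[of h] by simp
      then show "c h * (x h (Suc m) * z h (Suc m - h)) = c h * x h (Suc m) * y h (m - h) + c h * x h (Suc m) * y h (Suc m - h)"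
        by (simp add: distrib_left distrib_right mult_ac)
    qed simp
    also have "(\<Sum>h\<le>m. c h * (x (Suc h) (Suc m) * z (Suc h) (m - h)))
        = (\<Sum>h\<le>m. c h * x h m * y h (m - h)) + (\<Sum>h\<le>m. c h * x h (Suc m) * y h (m - h))"
      unfolding sum.distrib[symmetric] x by (intro sum.cong) (simp_all add: z_def y_def distrib_left distrib_right mult_ac)
    finally have "(\<Sum>h\<le>j. (-1) ^ h * real (Suc i choose h) * real ((d - Suc i
        + h) choose j) * real ((e - h) choose (j - h)))
      = (\<Sum>h\<le>Suc m. c h * x h (Suc m) * y h (Suc m - h)) - (\<Sum>h\<le>m. c h * x h m * y h (m - h))"
      by (simp add: y_def)
    also have "\<dots> = eberlein d' e' (Suc m) i - eberlein d' e' m i"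
      unfolding Suc.IH[OF de(3,4)] by (simp add: c_def x_def y_def)
    finally show ?thesis unfolding Suc de eberlein_Suc by simp
  qed
qed

text \<open>Deleting \<open>S\<close> from \<open>T'\<close> leaves a set that misses
  \<open>j\<close> of the \<open>d - card S + h\<close> points of \<open>T - S\<close> and takes
  \<open>j - h\<close> of the \<open>e - h\<close> points outside \<open>S\<close> and
  \<open>T\<close>. The count depends on \<open>T\<close> only through \<open>h\<close>.\<close>

lemma card_superset_nbrs:
  assumes "finite X" "card X = d
      + e" "S \<subseteq> X" "T \<subseteq> X" "card T = d" "h = card (S - T)" "card S \<le> d" "d \<le> e"
  shows "card {T'. T' \<subseteq> X \<and> card T' = d \<and> S \<subseteq> T' \<and> card (T - T') = j}
    = (if h \<le> j then ((d - card S + h) choose j) * ((e - h) choose (j - h)) else 0)"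
proof -
  have fin: "finite S" "finite T" using assms by (auto intro: finite_subset)
  define Y where "Y = T - S"
  have cS: "card S = card (S \<inter> T) + h"
    using fin assms(6) card_Int_Diff[of S T] by simp
  have cT: "d = card (S \<inter> T) + card Y"
    using fin assms(5) card_Int_Diff[of T S] by (simp add: Y_def Int_commute)
  have cY: "card Y = d - card S + h" using cS cT assms(7) by simp
  have cXS: "card (X - S - Y) = e - h"
  proof -
    have "X - S - Y = X - (S \<union> T)" by (auto simp: Y_def)
    also have "card \<dots> = card X - card (S \<union> T)"
      using assms fin by (simp add: card_Diff_subset)
    also have "card (S \<union> T) = d + h"
      using card_Un_Int[OF fin] cS assms(5) by simp
    finally show ?thesis using assms(2) by simp
  qed
  have count: "card {T'. T' \<subseteq> X \<and> card T' = d \<and> S \<subseteq> T' \<and> card (T - T') = j}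
      = card {U. U \<subseteq> X - S \<and> card U = d - card S \<and> card (Y - U) = j}"
  proof (rule bij_betw_same_card[of "\<lambda>T'. T' - S"], rule bij_betwI[where g = "\<lambda>U. U \<union> S"])
    have *: "T - T' = Y - (T' - S)" if "S \<subseteq> T'" for T' using that by (auto simp: Y_def)
    show "(\<lambda>T'. T' - S) \<in> {T'. T' \<subseteq> X \<and> card T' = d \<and> S \<subseteq> T' \<and> card (T - T') = j}
        \<rightarrow> {U. U \<subseteq> X - S \<and> card U = d - card S \<and> card (Y - U) = j}"
      using fin * by (auto simp: card_Diff_subset)
    show "(\<lambda>U. U \<union> S) \<in> {U. U \<subseteq> X - S \<and> card U = d - card S \<and> card (Y - U) = j}
        \<rightarrow> {T'. T' \<subseteq> X \<and> card T' = d \<and> S \<subseteq> T' \<and> card (T - T') = j}"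
    proof
      fix U assume U: "U \<in> {U. U \<subseteq> X - S \<and> card U = d - card S \<and> card (Y - U) = j}"
      then have "finite U" using assms(1) by (auto intro: finite_subset)
      then have "card (U \<union> S) = d" using U fin assms(7) by (subst card_Un_disjoint) auto
      moreover have "T - (U \<union> S) = Y - U" by (auto simp: Y_def)
      ultimately show "U \<union> S \<in> {T'. T' \<subseteq> X \<and> card T' = d \<and> S \<subseteq> T' \<and> card (T - T') = j}"
        using U assms(3) by auto
    qed
  qed auto
  have split: "card U = card (U \<inter> Y) + card (U - Y)" "card Y = card (U \<inter> Y)
      + card (Y - U)" if "U \<subseteq> X - S" for U
  proof -
    have "finite U" using that assms(1) by (auto intro: finite_subset)
    then show "card U = card (U \<inter> Y) + card (U - Y)" by (simp add: card_Int_Diff)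
    have "finite Y" using fin by (simp add: Y_def)
    then show "card Y = card (U \<inter> Y) + card (Y - U)" using card_Int_Diff[of Y U] by (simp add: Int_commute)
  qed
  show ?thesis
  proof (cases "h \<le> j \<and> j \<le> card Y")
    case True
    have "card U = d - card S \<and> card (Y
        - U) = j \<longleftrightarrow> card (U \<inter> Y) = card Y - j \<and> card (U - Y) = j - h"
      if "U \<subseteq> X - S" for U
      using split[OF that] True cY by linarith
    then have "{U. U \<subseteq> X - S \<and> card U = d - card S \<and> card (Y - U) = j}
        = {U. U \<subseteq> X - S \<and> card (U \<inter> Y) = card Y - j \<and> card (U - Y) = j - h}"
      by blast
    also have "card \<dots> = (card Y choose (card Y - j)) * (card (X - S - Y) choose (j - h))"
      using assms by (intro card_subsets_split) (auto simp: Y_def)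
    finally show ?thesis
      using count True binomial_symmetric[of j "card Y"] by (simp add: cXS cY)
  next
    case False
    have "{U. U \<subseteq> X - S \<and> card U = d - card S \<and> card (Y - U) = j} = {}"
    proof (rule equals0I)
      fix U assume "U \<in> {U. U \<subseteq> X - S \<and> card U = d - card S \<and> card (Y - U) = j}"
      then have "U \<subseteq> X - S" "card U = d - card S" "card (Y - U) = j" by auto
      then show False using split[of U] False cY by linarith
    qed
    then have "card {T'. T' \<subseteq> X \<and> card T' = d \<and> S \<subseteq> T' \<and> card (T - T') = j} = 0"
      unfolding count by (simp only: card.empty)
    then show ?thesis using False cY by auto
  qed
qed

lemma sum_subsets_card:
  assumes "finite S"
  shows "(\<Sum>Q | Q \<subseteq> S. g (card Q)) = (\<Sum>h\<le>card S. real (card S choose h) * g h)"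
proof -
  have "card ` {Q. Q \<subseteq> S} \<subseteq> {..card S}"
    using assms by (auto intro: card_mono)
  then have "(\<Sum>Q | Q \<subseteq> S. g (card Q)) = (\<Sum>h\<le>card S. \<Sum>Q | Q \<subseteq> S \<and> card Q = h. g (card Q))"
    using sum.group[of "{Q. Q \<subseteq> S}" "{..card S}" card "\<lambda>Q. g (card Q)"] assms
    by simp
  also have "\<dots> = (\<Sum>h\<le>card S. real (card S choose h) * g h)"
  proof (rule sum.cong)
    fix h
    have "(\<Sum>Q | Q \<subseteq> S \<and> card Q = h. g (card Q)) = (\<Sum>Q | Q \<subseteq> S \<and> card Q = h. g h)"
      by (rule sum.cong) auto
    then show "(\<Sum>Q | Q \<subseteq> S \<and> card Q = h. g (card Q)) = real (card S choose h) * g h"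
      using n_subsets[OF assms, of h] by simp
  qed simp
  finally show ?thesis .
qed

text \<open>Summing the eigenvalue equation over all \<open>T'\<close> containing a minimal
  \<open>S\<close> yields a multiple of \<open>w S S\<close> on both sides, and
  \<open>eberlein_alt\<close> identifies the factor.\<close>

lemma eigenvalue_is_eberlein:
  fixes f :: "'a set \<Rightarrow> real"
  assumes "finite X" "card X = d + e" "d \<le> e"
    and eigen: "\<And>S. S \<subseteq> X \<Longrightarrow> card S = d \<Longrightarrow> (\<Sum>T\<in>nbrs X d j S. f T) = \<mu> * f S"
    and "S\<^sub>0 \<subseteq> X" "card S\<^sub>0 = d" "f S\<^sub>0 \<noteq> 0"
  shows "\<exists>i\<le>d. \<mu> = eberlein d e j i"
proof -
  define V where "V = {T. T \<subseteq> X \<and> card T = d}"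
  define w where "w R S = (\<Sum>T | T \<in> V \<and> T \<inter> S = R. f T)" for R S
  have fin: "finite V" unfolding V_def using assms(1) by (auto intro: finite_subset[of _ "{T. T \<subseteq> X}"])
  define P where "P i \<longleftrightarrow> (\<exists>S R. S \<subseteq> X \<and> R \<subseteq> S \<and> card S = i \<and> w R S \<noteq> 0)" for i
  have "{T. T \<in> V \<and> T \<inter> S\<^sub>0 = S\<^sub>0} = {S\<^sub>0}"
  proof -
    have "T = S\<^sub>0" if "T \<in> V" "T \<inter> S\<^sub>0 = S\<^sub>0" for T
      using card_subset_eq[of T S\<^sub>0] that assms(1,6) unfolding V_def by (auto intro: finite_subset)
    then show ?thesis using assms(5,6) by (auto simp: V_def)
  qed
  then have "w S\<^sub>0 S\<^sub>0 = f S\<^sub>0" by (simp add: w_def)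
  then have "P d" unfolding P_def using assms(5-7) by (intro exI[of _ S\<^sub>0]) auto
  define i where "i = (LEAST i. P i)"
  have "P i" unfolding i_def using \<open>P d\<close> by (rule LeastI)
  then obtain S R where S: "S \<subseteq> X" "R \<subseteq> S" "card S = i" "w R S \<noteq> 0"
    unfolding P_def by blast
  have "i \<le> d" unfolding i_def using \<open>P d\<close> by (rule Least_le)
  have finS: "finite S" using S(1) assms(1) by (rule finite_subset)
  \<comment> \<open>The sum for \<open>S - {x}\<close> vanishes by minimality of \<open>S\<close>,
    and it splits according to whether \<open>x \<in> T\<close>.\<close>
  have step: "w Q S = - w (insert x Q) S" if "Q \<subseteq> S" "x \<in> S" "x \<notin> Q" for Q x
  proof -
    have "w Q (S - {x}) = w Q S + w (insert x Q) S"
    proof -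
      have "{T. T \<in> V \<and> T \<inter> (S
          - {x}) = Q} = {T. T \<in> V \<and> T \<inter> S = Q} \<union> {T. T \<in> V \<and> T \<inter> S = insert x Q}"
        using that by auto
      moreover have "{T. T \<in> V \<and> T \<inter> S = Q} \<inter> {T. T \<in> V \<and> T \<inter> S = insert x Q} = {}"
        using that by auto
      ultimately show ?thesis
        unfolding w_def using fin by (simp add: sum.union_disjoint)
    qed
    moreover have "w Q (S - {x}) = 0"
    proof (rule ccontr)
      assume "w Q (S - {x}) \<noteq> 0"
      then have "P (card (S - {x}))" unfolding P_def using S(1) that by (intro exI[of _ "S - {x}"] exI[of _ Q]) auto
      then have "i \<le> card (S - {x})" unfolding i_def by (rule Least_le)
      moreover have "card (S - {x}) < card S" using finS that(2) by (rule card_Diff1_less)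
      ultimately show False using S(3) by simp
    qed
    ultimately show ?thesis by simp
  qed
  have w: "w (S - Q) S = (-1) ^ card Q * w S S" if "Q \<subseteq> S" for Q
    using finite_subset[OF that finS] that
  proof (induction Q rule: finite_induct)
    case (insert x Q)
    have "insert x (S - insert x Q) = S - Q" using insert by auto
    then have "w (S - insert x Q) S = - w (S - Q) S"
      using step[of "S - insert x Q" x] insert by simp
    then show ?case using insert by simp
  qed simp
  have wS: "w S S \<noteq> 0"
    using w[of "S - R"] S(2,4) by (auto simp: double_diff)
  define \<phi> where "\<phi> h = (if h \<le> j then real ((d - i + h) choose j) * real ((e - h) choose (j - h)) else 0)" for h
  \<comment> \<open>Exchanging the sums counts each \<open>T\<close> with weight
    \<open>\<phi> (card (S - T))\<close>; grouping by \<open>Q = S - T\<close> then brings in the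
    alternating values of \<open>w\<close>.\<close>
  have "\<mu> * w S S = (\<Sum>T' | T' \<in> V \<and> T' \<inter> S = S. \<Sum>T\<in>nbrs X d j T'. f T)"
    unfolding w_def sum_distrib_left using eigen by (intro sum.cong) (auto simp: V_def)
  also have "\<dots> = (\<Sum>T' | T' \<in> V \<and> T' \<inter> S = S. \<Sum>T\<in>V. if card (T - T') = j then f T else 0)"
  proof (rule sum.cong)
    fix T'
    have "nbrs X d j T' = {T \<in> V. card (T - T') = j}" by (auto simp: nbrs_def V_def)
    then show "(\<Sum>T\<in>nbrs X d j T'. f T) = (\<Sum>T\<in>V. if card (T - T') = j then f T else 0)"
      using fin by (simp add: sum.inter_filter)
  qed simp
  also have "\<dots> = (\<Sum>T\<in>V. \<Sum>T' | T' \<in> V \<and> T' \<inter> S = S. if card (T - T') = j then f T else 0)"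
    by (rule sum.swap)
  also have "\<dots> = (\<Sum>T\<in>V. \<phi> (card (S - T)) * f T)"
  proof (rule sum.cong)
    fix T assume T: "T \<in> V"
    have "(\<Sum>T' | T' \<in> V \<and> T' \<inter> S = S. if card (T - T') = j then f T else 0)
        = (\<Sum>T' | T' \<in> {T'. T' \<in> V \<and> T' \<inter> S = S} \<and> card (T - T') = j. f T)"
      by (rule sum.inter_filter[symmetric]) (use fin in simp)
    also have "{T'. T' \<in> {T'. T' \<in> V \<and> T' \<inter> S = S} \<and> card (T - T') = j}
        = {T'. T' \<subseteq> X \<and> card T' = d \<and> S \<subseteq> T' \<and> card (T - T') = j}"
      by (auto simp: V_def)
    also have "(\<Sum>T'\<in>\<dots>. f T) = \<phi> (card (S - T)) * f T"
      using card_superset_nbrs[OF assms(1,2) S(1), of T "card (S - T)" j] T S(3) \<open>i \<le> d\<close> assms(3)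
      by (simp add: V_def \<phi>_def)
    finally show "(\<Sum>T' | T' \<in> V \<and> T' \<inter> S = S. if card (T
        - T') = j then f T else 0) = \<phi> (card (S - T)) * f T" .
  qed simp
  also have "\<dots> = (\<Sum>Q | Q \<subseteq> S. \<Sum>T | T \<in> V \<and> S - T = Q. \<phi> (card (S - T)) * f T)"
    using fin finS by (intro sum.group[symmetric]) auto
  also have "\<dots> = (\<Sum>Q | Q \<subseteq> S. \<phi> (card Q) * w (S - Q) S)"
  proof (rule sum.cong)
    fix Q assume "Q \<in> {Q. Q \<subseteq> S}"
    then have "{T. T \<in> V \<and> S - T = Q} = {T. T \<in> V \<and> T \<inter> S = S - Q}" by auto
    moreover have "(\<Sum>T | T \<in> V \<and> S - T = Q. \<phi> (card (S
        - T)) * f T) = (\<Sum>T | T \<in> V \<and> S - T = Q. \<phi> (card Q) * f T)"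
      by (rule sum.cong) auto
    ultimately show "(\<Sum>T | T \<in> V \<and> S - T = Q. \<phi> (card (S - T)) * f T) = \<phi> (card Q) * w (S - Q) S"
      by (simp add: w_def sum_distrib_left)
  qed simp
  also have "\<dots> = (\<Sum>Q | Q \<subseteq> S. \<phi> (card Q) * (-1) ^ card Q) * w S S"
    unfolding sum_distrib_right using w by (intro sum.cong) auto
  also have "(\<Sum>Q | Q \<subseteq> S. \<phi> (card Q) * (-1) ^ card Q) = (\<Sum>h\<le>i. real (i choose h) * (\<phi> h * (-1) ^ h))"
    using sum_subsets_card[OF finS, of "\<lambda>h. \<phi> h * (-1) ^ h"] S(3) by simp
  \<comment> \<open>Passing through \<open>i + j\<close> changes the upper limit from
    \<open>i\<close> to \<open>j\<close>: the terms added have \<open>i choose h = 0\<close>, those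
    removed have \<open>\<phi> h = 0\<close>.\<close>
  also have "\<dots> = (\<Sum>h\<le>i + j. real (i choose h) * (\<phi> h * (-1) ^ h))"
    by (rule sum.mono_neutral_left) auto
  also have "\<dots> = (\<Sum>h\<le>j. real (i choose h) * (\<phi> h * (-1) ^ h))"
    by (rule sum.mono_neutral_right) (auto simp: \<phi>_def)
  also have "\<dots> = eberlein d e j i"
    using \<open>i \<le> d\<close> assms(3) by (subst eberlein_alt) (auto simp: \<phi>_def mult_ac intro!: sum.cong)
  finally have "\<mu> = eberlein d e j i" using wS by simp
  then show ?thesis using \<open>i \<le> d\<close> by blast
qed

lemma graph_spectrum_johnson_graph:
  assumes "2 * d \<le> n" "0 < j" "j \<le> d"
  shows "graph_spectrum (johnson_graph n d j) = eberlein d (n - d) j ` {0..d}"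
proof (rule Set.set_eqI)
  fix \<mu>
  let ?G = "johnson_graph n d j"
  let ?X = "{0..<n}"
  have verts: "pverts ?G = {S. S \<subseteq> ?X \<and> card S = d}"
    by (simp add: johnson_graph_def)
  then have fin: "finite (pverts ?G)"
    by (auto intro: finite_subset[of _ "{S. S \<subseteq> ?X}"])
  have nb: "{T. T \<in> pverts ?G \<and> (S, T) \<in> parcs ?G} = nbrs ?X d j S" if "S \<in> pverts ?G" for S
    using that assms(3) nbrs_eq[of ?X S d j] by (auto simp: johnson_graph_def)
  have iff: "\<mu> \<in> graph_spectrum ?G \<longleftrightarrow> (\<exists>f. (\<exists>S. S \<subseteq> ?X \<and> card S = d \<and> f S \<noteq> 0) \<and>
      (\<forall>S. S \<subseteq> ?X \<longrightarrow> card S = d \<longrightarrow> (\<Sum>T\<in>nbrs ?X d j S. f T) = \<mu> * f S))"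
    unfolding graph_spectrum_iff[OF fin] using nb by (simp add: verts Bex_def imp_conjL)
  show "\<mu> \<in> graph_spectrum ?G \<longleftrightarrow> \<mu> \<in> eberlein d (n - d) j ` {0..d}"
  proof
    assume "\<mu> \<in> graph_spectrum ?G"
    then obtain f S\<^sub>0 where "S\<^sub>0 \<subseteq> ?X" "card S\<^sub>0 = d" "f S\<^sub>0 \<noteq> 0"
      "\<And>S. S \<subseteq> ?X \<Longrightarrow> card S = d \<Longrightarrow> (\<Sum>T\<in>nbrs ?X d j S. f T) = \<mu> * f S"
      unfolding iff by blast
    then have "\<exists>i\<le>d. \<mu> = eberlein d (n - d) j i"
      using assms(1) by (intro eigenvalue_is_eberlein[of ?X d "n - d" f j \<mu> S\<^sub>0]) auto
    then show "\<mu> \<in> eberlein d (n - d) j ` {0..d}" by auto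
  next
    assume "\<mu> \<in> eberlein d (n - d) j ` {0..d}"
    then obtain i where i: "i \<le> d" "\<mu> = eberlein d (n - d) j i" by auto
    obtain f where f: "f {0..<d} \<noteq> 0"
      "\<And>S. S \<subseteq> ?X \<Longrightarrow> card S = d \<Longrightarrow> (\<Sum>T\<in>nbrs ?X d j S. f T) = eberlein d (n - d) j i * f S"
    proof (rule eberlein_eigenvalue[OF assms(1) i(1), where j = j])
      fix g :: "nat set \<Rightarrow> real"
      assume "g {0..<d} \<noteq> 0"
        "\<And>S. S \<subseteq> ?X \<Longrightarrow> card S = d \<Longrightarrow> (\<Sum>T\<in>nbrs ?X d j S. g T) = eberlein d (n - d) j i * g S"
      then show ?thesis by (rule that)
    qed
    show "\<mu> \<in> graph_spectrum ?G"
      unfolding iff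
      unfolding i(2)
    proof (intro exI[of _ f] conjI exI[of _ "{0..<d}"] allI impI)
      show "f {0..<d} \<noteq> 0" by (rule f(1))
    qed (use assms(1) f(2) in simp_all)
  qed
qed

theorem theorem3p10:
  fixes n d j e :: nat
  assumes "2 * d \<le> n" and "0 < j" and "j \<le> d" and "e = n - d"
  shows "graph_spectrum (johnson_graph n d j) = johnson_eigenvalue n d j ` {0..d}
    \<and> (smallest_eigenvalue (johnson_graph n d j) (johnson_eigenvalue n d j 1)
         \<longleftrightarrow> d * e \<le> j * (n - 1))
    \<and> ((\<forall>i\<in>{0..d}. johnson_eigenvalue n d j 1 \<le> johnson_eigenvalue n d j i)
         \<longleftrightarrow> d * e \<le> j * (n - 1))
    \<and> (d * e \<le> j * (n - 1) \<longrightarrow>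
         (\<forall>i\<in>{1..d}. \<bar>johnson_eigenvalue n d j i\<bar> \<le> \<bar>johnson_eigenvalue n d j 1\<bar>))"
proof -
  have E: "johnson_eigenvalue n d j i = eberlein d e j i" for i
    by (simp add: johnson_eigenvalue_eq_eberlein assms(4))
  have de: "d \<le> e" "n = d + e" "1 \<le> d" using assms by auto
  have "real (n - 1) = real d + real e - 1" using de by simp
  then have "d * e \<le> j * (n - 1) \<longleftrightarrow> real d * real e \<le> real j * (real d + real e - 1)"
    by (metis of_nat_le_iff of_nat_mult)
  note cond = this
  have spec: "graph_spectrum (johnson_graph n d j) = johnson_eigenvalue n d j ` {0..d}"
    unfolding graph_spectrum_johnson_graph[OF assms(1-3)] E assms(4) ..
  have min: "(\<forall>i\<in>{0..d}. johnson_eigenvalue n d j 1 \<le> johnson_eigenvalue n d j i)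
      \<longleftrightarrow> d * e \<le> j * (n - 1)"
    unfolding E cond by (rule eberlein_1_minimal_iff[OF de(1) assms(2,3)])
  moreover have "smallest_eigenvalue (johnson_graph n d j) (johnson_eigenvalue n d j 1)
      \<longleftrightarrow> (\<forall>i\<in>{0..d}. johnson_eigenvalue n d j 1 \<le> johnson_eigenvalue n d j i)"
    unfolding smallest_eigenvalue_def spec using de(3) by auto
  moreover have "\<bar>johnson_eigenvalue n d j i\<bar> \<le> \<bar>johnson_eigenvalue n d j 1\<bar>"
    if "d * e \<le> j * (n - 1)" "i \<in> {1..d}" for i
    using abs_eberlein_le_abs_eberlein_1[of i d e j] that de unfolding E cond by simp
  ultimately show ?thesis using spec by blast
qed

end
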